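(* Let $(M,\gamma;\mathbb J_\pm,g)$ be a generalized Kähler manifold. Under the natural isomorphisms of complex vector bundles $\bar\ell_\mp\cong\mathcal A_\pm$, the operator $\bar\delta_\pm$ on $\bar\ell_\mp^*$ is induced by the operator $\bar\partial_\pm$ (the $I_\pm$-holomorphic structure) on $\mathcal A_\pm$; that is, $\bar\delta_\pm$ on $\bar\ell_\mp^*$ coincides with the dual holomorphic structure on $\mathcal A_\pm^*\cong\bar\ell_\mp^*$.
   Context: For a manifold $M$ with closed $\gamma\in\Omega^3(M)$, $\mathbb TM=TM\oplus T^*M$ carries the pairing $\langle X+\xi,Y+\eta\rangle=\frac12(\iota_X\eta+\iota_Y\xi)$, the Dorfman bracket $(X+\xi)*(Y+\eta)=[X,Y]+\mathcal L_X\eta-\iota_Yd\xi+\iota_X\iota_Y\gamma$ and the projection $a:\mathbb TM\to TM$. A generalized complex structure is an orthogonal $\mathbb J:\mathbb TM\to\mathbb TM$ with $\mathbb J^2=-1$ whose $i$-eigenbundle $L\subset\mathbb TM\otimes\mathbb C$ is closed under $*$. A generalized Kähler structure $(M,\gamma;\mathbb J_\pm,g)$ is a pair of commuting generalized complex structures with $-\mathbb J_+\mathbb J_-=\begin{pmatrix}0&g^{-1}\\ g&0\end{pmatrix}$, $g$ a Riemannian metric. With $L_\pm$ the $i$-eigenbundle of $\mathbb J_\pm$, set $\ell_+=L_+\cap L_-$, $\ell_-=L_+\cap\bar L_-$, so $L_+=\ell_+\oplus\ell_-$. The formulas $I_\pm(X)=a(\mathbb J_+(X\pm g(X)))$ define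 integrable $g$-orthogonal complex structures, and $a$ identifies $\bar\ell_\pm$ with the antiholomorphic tangent bundle $T^\pm_{0,1}M$ of $I_\pm$ as Lie algebroids; hence $C^\infty(\wedge^p\bar\ell_\pm^* )\cong\Omega^{0,p}_\pm(M)$. Bismut connections: $\nabla^\pm_XY=\nabla_XY\pm\frac12g^{-1}\iota_X\iota_Y\gamma$ ($\nabla$ Levi-Civita); they satisfy $\nabla^\pm g=0$, $\nabla^\pm I_\pm=0$. Let $\bar\partial_\pm$ be the Dolbeault operator of $I_\pm$. Let $\bar\partial^{\mp}$ denote the composition $\Omega^*(M)\xrightarrow{\nabla^\pm}\Omega^*(M)\otimes\Omega^1(M)\to\Omega^*(M)\otimes\Omega^{0,1}_\mp(M)$ (so $\bar\partial^-$ uses $\nabla^+$ and the projection to $\Omega^{0,1}_-$, and $\bar\partial^+$ uses $\nabla^-$ and the projection to $\Omega_+^{0,1}$). On $\Omega^{p,q}(\bar L_+)=C^\infty(\wedge^p\bar\ell_+^*\otimes\wedge^q\bar\ell_-^* )\cong\Omega^{0,p}_+(M)\otimes\Omega^{0,q}_-(M)$ (tensor over functions) set $\bar\delta_+=\bar\partial_++\bar\partial^+:\Omega^{p,q}\to\Omega^{p+1,q}$ and $\bar\delta_-=\bar\partial_-+\bar\partial^-:\Omega^{p,q}\to\Omega^{p,q+1}$, e.g. $\bar\delta_+(\alpha\wedge\beta)=\bar\partial_+\alpha\wedge\beta+(-1)^p\alpha\wedge\bar\partial^+\beta$ for $\alpha\in\Omega^{p,0}(\bar L_+)$, $\beta\in\Omega^{0,q}(\bar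 L_+)$. In particular $\bar\delta_+=\bar\partial^+$ on $\bar\ell_-^*$ and $\bar\delta_-=\bar\partial^-$ on $\bar\ell_+^*$. Holomorphic reduction: $\mathcal A_+:=(\bar\ell_+\oplus\bar\ell_-)/\bar\ell_+\cong\bar\ell_-$ is an $I_+$-holomorphic vector bundle with $\bar\partial_{+,X}\mathfrak Y_A=(\mathfrak X*\mathfrak Y)_A$ for $\mathfrak X\in C^\infty(\bar\ell_+)$, $X=a(\mathfrak X)\in T^+_{0,1}M$, $\mathfrak Y\in C^\infty(\bar L_+)$, $(\cdot)_A$ denoting the class in $\mathcal A_+$. Symmetrically $\mathcal A_-:=(\bar\ell_+\oplus\bar\ell_-)/\bar\ell_-\cong\bar\ell_+$ is $I_-$-holomorphic with $\bar\partial_{-,X}\mathfrak Y_A=(\mathfrak X*\mathfrak Y)_A$ for $\mathfrak X\in C^\infty(\bar\ell_-)$, $X=a(\mathfrak X)$. *)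

theory Defs
  imports "HOL-Analysis.Analysis" "HOL-Library.Function_Algebras"
begin

section \<open>Smooth manifolds\<close>

text \<open>\<open>C\<^sup>k\<close> on an open set: all iterated directional derivatives up to order \<open>k\<close> exist and are
  continuous.\<close>

fun Ck_on :: "nat \<Rightarrow> 'e::euclidean_space set \<Rightarrow> ('e \<Rightarrow> 'f::real_normed_vector) \<Rightarrow> bool" where
  "Ck_on 0 S f \<longleftrightarrow> continuous_on S f"
| "Ck_on (Suc k) S f \<longleftrightarrow> (\<forall>x\<in>S. f differentiable (at x))
      \<and> (\<forall>v. Ck_on k S (\<lambda>x. frechet_derivative f (at x) v))"

definition Cinf_on :: "'e::euclidean_space set \<Rightarrow> ('e \<Rightarrow> 'f::real_normed_vector) \<Rightarrow> bool" where
  "Cinf_on S f \<longleftrightarrow> (\<forall>k. Ck_on k S f)"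

lemma Ck_on_cong:
  assumes "open S" "\<And>x. x \<in> S \<Longrightarrow> f x = g x"
  shows "Ck_on k S f \<longleftrightarrow> Ck_on k S g"
  using assms(2)
proof (induction k arbitrary: f g)
  case 0
  then show ?case by (simp cong: continuous_on_cong)
next
  case (Suc k)
  have d: "f differentiable (at x) \<longleftrightarrow> g differentiable (at x)" if "x \<in> S" for x
    unfolding differentiable_def
    by (intro iff_exI iffI; erule has_derivative_transform_within_open[OF _ assms(1) that])
      (auto simp: Suc.prems)
  have "frechet_derivative f (at x) = frechet_derivative g (at x)"
    if "x \<in> S" "f differentiable (at x)" for x
    using frechet_derivative_transform_within_open[OF that(2) assms(1) that(1)] Suc.prems by blast
  then have "Ck_on k S (\<lambda>x. frechet_derivative f (at x) v) \<longleftrightarrow>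
      Ck_on k S (\<lambda>x. frechet_derivative g (at x) v)" if "\<forall>x\<in>S. f differentiable (at x)" for v
    using that by (intro Suc.IH) auto
  then show ?case using d by auto
qed

lemma Ck_on_Suc_imp: "Ck_on (Suc k) S f \<Longrightarrow> Ck_on k S f"
proof (induction k arbitrary: f)
  case 0
  then show ?case
    by (auto intro!: continuous_at_imp_continuous_on differentiable_imp_continuous_within)
qed auto

lemma Ck_on_add:
  assumes "open S"
  shows "Ck_on k S f \<Longrightarrow> Ck_on k S g \<Longrightarrow> Ck_on k S (\<lambda>x. f x + g x)"
proof (induction k arbitrary: f g)
  case 0
  then show ?case by (simp add: continuous_on_add)
next
  case (Suc k)
  have "Ck_on k S (\<lambda>x. frechet_derivative (\<lambda>x. f x + g x) (at x) v)" for v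
  proof -
    have "Ck_on k S (\<lambda>x. frechet_derivative f (at x) v + frechet_derivative g (at x) v)"
      using Suc by auto
    moreover have "frechet_derivative (\<lambda>x. f x + g x) (at x) v
        = frechet_derivative f (at x) v + frechet_derivative g (at x) v" if "x \<in> S" for x
    proof -
      have "(f has_derivative frechet_derivative f (at x)) (at x)"
        "(g has_derivative frechet_derivative g (at x)) (at x)"
        using Suc.prems that by (auto simp: frechet_derivative_works[symmetric])
      from fun_cong[OF frechet_derivative_at[OF has_derivative_add[OF this]], of v]
      show ?thesis by simp
    qed
    ultimately show ?thesis by (rule iffD2[OF Ck_on_cong[OF assms], rotated])
  qed
  then show ?case using Suc.prems by auto
qed

lemma Ck_on_mult:
  fixes f g :: "'e::euclidean_space \<Rightarrow> real"
  assumes "open S"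
  shows "Ck_on k S f \<Longrightarrow> Ck_on k S g \<Longrightarrow> Ck_on k S (\<lambda>x. f x * g x)"
proof (induction k arbitrary: f g)
  case 0
  then show ?case by (simp add: continuous_on_mult)
next
  case (Suc k)
  have "Ck_on k S (\<lambda>x. frechet_derivative (\<lambda>x. f x * g x) (at x) v)" for v
  proof -
    have "Ck_on k S (\<lambda>x. f x * frechet_derivative g (at x) v + frechet_derivative f (at x) v * g x)"
      using Suc Ck_on_Suc_imp[OF Suc.prems(1)] Ck_on_Suc_imp[OF Suc.prems(2)]
      by (intro Ck_on_add[OF assms] Suc.IH) auto
    moreover have "frechet_derivative (\<lambda>x. f x * g x) (at x) v
        = f x * frechet_derivative g (at x) v + frechet_derivative f (at x) v * g x"
      if "x \<in> S" for x
    proof -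
      have "(f has_derivative frechet_derivative f (at x)) (at x)"
        "(g has_derivative frechet_derivative g (at x)) (at x)"
        using Suc.prems that by (auto simp: frechet_derivative_works[symmetric])
      from fun_cong[OF frechet_derivative_at[OF has_derivative_mult[OF this]], of v]
      show ?thesis by simp
    qed
    ultimately show ?thesis by (rule iffD2[OF Ck_on_cong[OF assms], rotated])
  qed
  then show ?case using Suc.prems by (auto intro: differentiable_mult)
qed

lemma Ck_on_const: "Ck_on k S (\<lambda>_. c)"
  by (induction k arbitrary: c) (auto simp: frechet_derivative_const)

type_synonym ('a, 'e) atlas = "('a set \<times> ('a \<Rightarrow> 'e)) set"

text \<open>The manifold is the whole point type; Hausdorff and second countable come from the sort.\<close>

definition smooth_atlas ::
  "('a::{t2_space,second_countable_topology}, 'e::euclidean_space) atlas \<Rightarrow> bool" where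
  "smooth_atlas A \<longleftrightarrow> (\<Union>(U, \<phi>)\<in>A. U) = UNIV
     \<and> (\<forall>(U, \<phi>)\<in>A. open U \<and> open (\<phi> ` U) \<and> homeomorphism U (\<phi> ` U) \<phi> (inv_into U \<phi>))
     \<and> (\<forall>(U, \<phi>)\<in>A. \<forall>(V, \<psi>)\<in>A. Cinf_on (\<phi> ` (U \<inter> V)) (\<psi> \<circ> inv_into U \<phi>))"

type_synonym 'a rfun = "'a \<Rightarrow> real"
type_synonym 'a cfun = "'a \<Rightarrow> complex"

definition smooth_fun ::
  "('a::{t2_space,second_countable_topology}, 'e::euclidean_space) atlas \<Rightarrow> 'a rfun set" where
  "smooth_fun A = {f. \<forall>(U, \<phi>)\<in>A. Cinf_on (\<phi> ` U) (f \<circ> inv_into U \<phi>)}"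

lemma smooth_fun_mult:
  assumes "smooth_atlas A" "f \<in> smooth_fun A" "h \<in> smooth_fun A"
  shows "f * h \<in> smooth_fun A"
proof -
  have "Ck_on k (\<phi> ` U) (f * h \<circ> inv_into U \<phi>)" if "(U, \<phi>) \<in> A" for U \<phi> k
  proof -
    have "open (\<phi> ` U)" "Ck_on k (\<phi> ` U) (f \<circ> inv_into U \<phi>)" "Ck_on k (\<phi> ` U) (h \<circ> inv_into U \<phi>)"
      using assms that by (auto simp: smooth_fun_def smooth_atlas_def Cinf_on_def)
    from Ck_on_mult[OF this] show ?thesis by (simp add: comp_def)
  qed
  then show ?thesis by (auto simp: smooth_fun_def Cinf_on_def)
qed

lemma smooth_fun_add:
  assumes "smooth_atlas A" "f \<in> smooth_fun A" "h \<in> smooth_fun A"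
  shows "f + h \<in> smooth_fun A"
proof -
  have "Ck_on k (\<phi> ` U) (f + h \<circ> inv_into U \<phi>)" if "(U, \<phi>) \<in> A" for U \<phi> k
  proof -
    have "open (\<phi> ` U)" "Ck_on k (\<phi> ` U) (f \<circ> inv_into U \<phi>)" "Ck_on k (\<phi> ` U) (h \<circ> inv_into U \<phi>)"
      using assms that by (auto simp: smooth_fun_def smooth_atlas_def Cinf_on_def)
    from Ck_on_add[OF this] show ?thesis by (simp add: comp_def)
  qed
  then show ?thesis by (auto simp: smooth_fun_def Cinf_on_def)
qed

lemma smooth_fun_const: "(\<lambda>_. c) \<in> smooth_fun A"
  unfolding smooth_fun_def Cinf_on_def by (auto simp: comp_def Ck_on_const)

definition csmooth_fun ::
  "('a::{t2_space,second_countable_topology}, 'e::euclidean_space) atlas \<Rightarrow> 'a cfun set" where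
  "csmooth_fun A = {f. Re \<circ> f \<in> smooth_fun A \<and> Im \<circ> f \<in> smooth_fun A}"

text \<open>Smooth sections of tensor bundles are used throughout: vector fields are derivations of
  \<open>C\<^sup>\<infinity>(M)\<close>, tensor fields are \<open>C\<^sup>\<infinity>(M)\<close>-multilinear maps of vector fields, and bundle maps are
  \<open>C\<^sup>\<infinity>(M)\<close>-linear maps of sections.  Vector fields and one-forms vanish outside their natural
  domain, so that equality of functions is equality of sections.\<close>

type_synonym 'a vf = "'a rfun \<Rightarrow> 'a rfun"
type_synonym 'a oneform = "'a vf \<Rightarrow> 'a rfun"

definition scl :: "'a rfun \<Rightarrow> ('b \<Rightarrow> 'a rfun) \<Rightarrow> ('b \<Rightarrow> 'a rfun)" where
  "scl f s = (\<lambda>x. f * s x)"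

definition vfields ::
  "('a::{t2_space,second_countable_topology}, 'e::euclidean_space) atlas \<Rightarrow> 'a vf set" where
  "vfields A = {X.
      (\<forall>f\<in>smooth_fun A. X f \<in> smooth_fun A)
    \<and> (\<forall>f\<in>smooth_fun A. \<forall>h\<in>smooth_fun A. X (f + h) = X f + X h)
    \<and> (\<forall>c. \<forall>f\<in>smooth_fun A. X ((\<lambda>_. c) * f) = (\<lambda>_. c) * X f)
    \<and> (\<forall>f\<in>smooth_fun A. \<forall>h\<in>smooth_fun A. X (f * h) = X f * h + f * X h)
    \<and> (\<forall>f. f \<notin> smooth_fun A \<longrightarrow> X f = 0)}"

definition lie :: "'a vf \<Rightarrow> 'a vf \<Rightarrow> 'a vf" where
  "lie X Y = (\<lambda>f. X (Y f) - Y (X f))"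

definition oneforms ::
  "('a::{t2_space,second_countable_topology}, 'e::euclidean_space) atlas \<Rightarrow> 'a oneform set" where
  "oneforms A = {\<xi>.
      (\<forall>X\<in>vfields A. \<xi> X \<in> smooth_fun A)
    \<and> (\<forall>f\<in>smooth_fun A. \<forall>X\<in>vfields A. \<forall>Y\<in>vfields A. \<xi> (scl f X + Y) = f * \<xi> X + \<xi> Y)
    \<and> (\<forall>X. X \<notin> vfields A \<longrightarrow> \<xi> X = 0)}"

text \<open>Forms of higher degree take the list of their arguments.\<close>

definition kforms ::
  "('a::{t2_space,second_countable_topology}, 'e::euclidean_space) atlas
     \<Rightarrow> nat \<Rightarrow> ('a vf list \<Rightarrow> 'a rfun) set" where
  "kforms A k = {\<omega>. \<forall>Xs. length Xs = k \<longrightarrow> set Xs \<subseteq> vfields A \<longrightarrow>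
      \<omega> Xs \<in> smooth_fun A
    \<and> (\<forall>i<k. \<forall>f\<in>smooth_fun A. \<forall>X\<in>vfields A. \<forall>Y\<in>vfields A.
         \<omega> (Xs[i := scl f X + Y]) = f * \<omega> (Xs[i := X]) + \<omega> (Xs[i := Y]))
    \<and> (\<forall>i<k. \<forall>j<k. i \<noteq> j \<longrightarrow> Xs ! i = Xs ! j \<longrightarrow> \<omega> Xs = 0)}"

definition drop_nth :: "nat \<Rightarrow> 'b list \<Rightarrow> 'b list" where
  "drop_nth i xs = take i xs @ drop (Suc i) xs"

text \<open>The Cartan (Chevalley-Eilenberg) formula for a bracket \<open>br\<close> and a derivative \<open>act\<close> on the
  coefficients.\<close>

definition cartan_diff ::
  "('x \<Rightarrow> 'm \<Rightarrow> 'm) \<Rightarrow> ('x \<Rightarrow> 'x \<Rightarrow> 'x) \<Rightarrow> ('x list \<Rightarrow> 'm) \<Rightarrow> 'x list \<Rightarrow> 'm::comm_ring_1" where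
  "cartan_diff act br \<omega> Xs =
      (\<Sum>i<length Xs. (-1) ^ i * act (Xs ! i) (\<omega> (drop_nth i Xs)))
    + (\<Sum>j<length Xs. \<Sum>i<j.
         (-1) ^ (i + j) * \<omega> (br (Xs ! i) (Xs ! j) # drop_nth i (drop_nth j Xs)))"

definition closed_kform ::
  "('a::{t2_space,second_countable_topology}, 'e::euclidean_space) atlas
     \<Rightarrow> nat \<Rightarrow> ('a vf list \<Rightarrow> 'a rfun) \<Rightarrow> bool" where
  "closed_kform A k \<omega> \<longleftrightarrow> \<omega> \<in> kforms A k
    \<and> (\<forall>Xs. length Xs = Suc k \<longrightarrow> set Xs \<subseteq> vfields A \<longrightarrow> cartan_diff (\<lambda>X f. X f) lie \<omega> Xs = 0)"

section \<open>Complexification\<close>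

text \<open>\<open>Cpx s t\<close> is the section \<open>s + i t\<close> of \<open>E \<otimes> \<complex>\<close>.\<close>

datatype 'v cpx = Cpx (re: 'v) (im: 'v)

instantiation cpx :: (ab_group_add) ab_group_add
begin
definition "0 = Cpx 0 0"
definition "u + v = Cpx (re u + re v) (im u + im v)"
definition "u - v = Cpx (re u - re v) (im u - im v)"
definition "- u = Cpx (- re u) (- im u)"
instance
  by standard (auto simp: zero_cpx_def plus_cpx_def minus_cpx_def uminus_cpx_def
      algebra_simps intro: cpx.expand)
end

definition ii :: "'v::ab_group_add cpx \<Rightarrow> 'v cpx" where
  "ii u = Cpx (- im u) (re u)"

definition cconj :: "'v::ab_group_add cpx \<Rightarrow> 'v cpx" where
  "cconj u = Cpx (re u) (- im u)"

text \<open>Complex linear and complex bilinear extension of real maps.\<close>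

definition cext :: "('v \<Rightarrow> 'w) \<Rightarrow> 'v cpx \<Rightarrow> 'w cpx" where
  "cext F u = Cpx (F (re u)) (F (im u))"

definition cext2 :: "('v \<Rightarrow> 'w \<Rightarrow> 'z::ab_group_add) \<Rightarrow> 'v cpx \<Rightarrow> 'w cpx \<Rightarrow> 'z cpx" where
  "cext2 B u v = Cpx (B (re u) (re v) - B (im u) (im v)) (B (re u) (im v) + B (im u) (re v))"

definition cvfields ::
  "('a::{t2_space,second_countable_topology}, 'e::euclidean_space) atlas \<Rightarrow> 'a vf cpx set" where
  "cvfields A = {X. re X \<in> vfields A \<and> im X \<in> vfields A}"

text \<open>The derivative of a complex function along a complex vector field.\<close>

definition cact :: "'a vf cpx \<Rightarrow> 'a cfun \<Rightarrow> 'a cfun" where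
  "cact X f = (\<lambda>p. Complex (re X (Re \<circ> f) p - im X (Im \<circ> f) p)
                           (re X (Im \<circ> f) p + im X (Re \<circ> f) p))"

lemma cact_mult:
  assumes A: "smooth_atlas A" and X: "X \<in> cvfields A"
    and f: "f \<in> csmooth_fun A" and h: "h \<in> csmooth_fun A"
  shows "cact X (f * h) = cact X f * h + f * cact X h"
proof -
  let ?fr = "Re \<circ> f" and ?fi = "Im \<circ> f" and ?hr = "Re \<circ> h" and ?hi = "Im \<circ> h"
  have sm: "?fr \<in> smooth_fun A" "?fi \<in> smooth_fun A" "?hr \<in> smooth_fun A" "?hi \<in> smooth_fun A"
    using f h by (auto simp: csmooth_fun_def)
  have re: "Re \<circ> (f * h) = ?fr * ?hr + (\<lambda>_. -1) * (?fi * ?hi)"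
    and im: "Im \<circ> (f * h) = ?fr * ?hi + ?fi * ?hr"
    by (auto simp: fun_eq_iff)
  have lin: "Y (a * b + (\<lambda>_. -1) * (c * d)) p
        = Y a p * b p + a p * Y b p - (Y c p * d p + c p * Y d p)"
      "Y (a * b + c * d) p = Y a p * b p + a p * Y b p + (Y c p * d p + c p * Y d p)"
    if Y: "Y \<in> vfields A" and s: "a \<in> smooth_fun A" "b \<in> smooth_fun A" "c \<in> smooth_fun A" "d \<in> smooth_fun A"
    for Y a b c d p
  proof -
    have P: "a * b \<in> smooth_fun A" "c * d \<in> smooth_fun A" "(\<lambda>_. -1) * (c * d) \<in> smooth_fun A"
      by (intro smooth_fun_mult[OF A] smooth_fun_const s)+
    have L: "Y (a * b) = Y a * b + a * Y b" "Y (c * d) = Y c * d + c * Y d"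
      using Y s by (auto simp: vfields_def)
    have "Y (a * b + (\<lambda>_. -1) * (c * d)) = Y (a * b) + (\<lambda>_. -1) * Y (c * d)"
      "Y (a * b + c * d) = Y (a * b) + Y (c * d)"
      using Y P unfolding vfields_def mem_Collect_eq by metis+
    then show "Y (a * b + (\<lambda>_. -1) * (c * d)) p
        = Y a p * b p + a p * Y b p - (Y c p * d p + c p * Y d p)"
      "Y (a * b + c * d) p = Y a p * b p + a p * Y b p + (Y c p * d p + c p * Y d p)"
      by (simp_all add: L)
  qed
  have V: "re X \<in> vfields A" "im X \<in> vfields A"
    using X by (auto simp: cvfields_def)
  show ?thesis
    unfolding cact_def re im
    by (rule ext) (simp add: lin[OF V(1)] lin[OF V(2)] sm complex_eq_iff algebra_simps)
qed

section \<open>Generalized complex and generalized Kaehler structures\<close>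

text \<open>Sections of \<open>TM \<oplus> T\<^sup>*M\<close>.\<close>

type_synonym 'a tt = "'a vf \<times> 'a oneform"

definition ttscl :: "'a rfun \<Rightarrow> 'a tt \<Rightarrow> 'a tt" where
  "ttscl f u = (scl f (fst u), scl f (snd u))"

definition cttscl :: "'a cfun \<Rightarrow> 'a tt cpx \<Rightarrow> 'a tt cpx" where
  "cttscl f u = Cpx (ttscl (Re \<circ> f) (re u) - ttscl (Im \<circ> f) (im u))
                    (ttscl (Re \<circ> f) (im u) + ttscl (Im \<circ> f) (re u))"

definition ttsections ::
  "('a::{t2_space,second_countable_topology}, 'e::euclidean_space) atlas \<Rightarrow> 'a tt set" where
  "ttsections A = vfields A \<times> oneforms A"

definition cttsections ::
  "('a::{t2_space,second_countable_topology}, 'e::euclidean_space) atlas \<Rightarrow> 'a tt cpx set" where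
  "cttsections A = {u. re u \<in> ttsections A \<and> im u \<in> ttsections A}"

abbreviation anchor :: "'a tt cpx \<Rightarrow> 'a vf cpx" where
  "anchor \<equiv> cext fst"

definition pairing :: "'a tt \<Rightarrow> 'a tt \<Rightarrow> 'a rfun" where
  "pairing u v = (\<lambda>p. 1/2 * (snd v (fst u) p + snd u (fst v) p))"

definition as_oneform ::
  "('a::{t2_space,second_countable_topology}, 'e::euclidean_space) atlas
     \<Rightarrow> ('a vf \<Rightarrow> 'a rfun) \<Rightarrow> 'a oneform" where
  "as_oneform A \<xi> = (\<lambda>Z. if Z \<in> vfields A then \<xi> Z else 0)"

text \<open>\<open>\<L>\<^sub>X \<eta>\<close>, \<open>\<iota>\<^sub>Y d\<xi>\<close> and \<open>\<iota>\<^sub>X \<iota>\<^sub>Y \<gamma> = \<gamma>(Y, X, \<cdot>)\<close>.\<close>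

definition lie_oneform where
  "lie_oneform A X \<eta> = as_oneform A (\<lambda>Z. X (\<eta> Z) - \<eta> (lie X Z))"

definition contract_d where
  "contract_d A Y \<xi> = as_oneform A (\<lambda>Z. Y (\<xi> Z) - Z (\<xi> Y) - \<xi> (lie Y Z))"

definition contract2 where
  "contract2 A X Y \<gamma> = as_oneform A (\<lambda>Z. \<gamma> [Y, X, Z])"

definition dorfman ::
  "('a::{t2_space,second_countable_topology}, 'e::euclidean_space) atlas
     \<Rightarrow> ('a vf list \<Rightarrow> 'a rfun) \<Rightarrow> 'a tt \<Rightarrow> 'a tt \<Rightarrow> 'a tt" where
  "dorfman A \<gamma> u v = (lie (fst u) (fst v),
     lie_oneform A (fst u) (snd v) - contract_d A (fst v) (snd u) + contract2 A (fst u) (fst v) \<gamma>)"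

definition eigenbundle ::
  "('a::{t2_space,second_countable_topology}, 'e::euclidean_space) atlas
     \<Rightarrow> ('a tt \<Rightarrow> 'a tt) \<Rightarrow> 'a tt cpx set" where
  "eigenbundle A J = {u \<in> cttsections A. cext J u = ii u}"

definition generalized_complex ::
  "('a::{t2_space,second_countable_topology}, 'e::euclidean_space) atlas
     \<Rightarrow> ('a vf list \<Rightarrow> 'a rfun) \<Rightarrow> ('a tt \<Rightarrow> 'a tt) \<Rightarrow> bool" where
  "generalized_complex A \<gamma> J \<longleftrightarrow>
      (\<forall>u\<in>ttsections A. J u \<in> ttsections A)
    \<and> (\<forall>f\<in>smooth_fun A. \<forall>u\<in>ttsections A. \<forall>v\<in>ttsections A. J (ttscl f u + v) = ttscl f (J u) + J v)
    \<and> (\<forall>u\<in>ttsections A. \<forall>v\<in>ttsections A. pairing (J u) (J v) = pairing u v)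
    \<and> (\<forall>u\<in>ttsections A. J (J u) = - u)
    \<and> (\<forall>u\<in>eigenbundle A J. \<forall>v\<in>eigenbundle A J. cext2 (dorfman A \<gamma>) u v \<in> eigenbundle A J)"

text \<open>A metric is given by its musical map: \<open>g X\<close> is the one-form \<open>g(X, \<cdot>)\<close>.\<close>

definition riemannian_metric ::
  "('a::{t2_space,second_countable_topology}, 'e::euclidean_space) atlas
     \<Rightarrow> ('a vf \<Rightarrow> 'a oneform) \<Rightarrow> bool" where
  "riemannian_metric A g \<longleftrightarrow>
      (\<forall>X\<in>vfields A. g X \<in> oneforms A)
    \<and> (\<forall>X\<in>vfields A. \<forall>Y\<in>vfields A. g X Y = g Y X)
    \<and> (\<forall>X\<in>vfields A. \<forall>p. (\<exists>f\<in>smooth_fun A. X f p \<noteq> 0) \<longrightarrow> g X X p > 0)"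

definition sharp ::
  "('a::{t2_space,second_countable_topology}, 'e::euclidean_space) atlas
     \<Rightarrow> ('a vf \<Rightarrow> 'a oneform) \<Rightarrow> 'a oneform \<Rightarrow> 'a vf" where
  "sharp A g = inv_into (vfields A) g"

record ('a, 'e) gk =
  atl :: "('a, 'e) atlas"
  gam :: "'a vf list \<Rightarrow> 'a rfun"
  Jp :: "'a tt \<Rightarrow> 'a tt"
  Jm :: "'a tt \<Rightarrow> 'a tt"
  met :: "'a vf \<Rightarrow> 'a oneform"

definition generalized_kaehler ::
  "('a::{t2_space,second_countable_topology}, 'e::euclidean_space) gk \<Rightarrow> bool" where
  "generalized_kaehler K \<longleftrightarrow>
      smooth_atlas (atl K)
    \<and> closed_kform (atl K) 3 (gam K)
    \<and> generalized_complex (atl K) (gam K) (Jp K)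
    \<and> generalized_complex (atl K) (gam K) (Jm K)
    \<and> (\<forall>u\<in>ttsections (atl K). Jp K (Jm K u) = Jm K (Jp K u))
    \<and> riemannian_metric (atl K) (met K)
    \<and> (\<forall>X\<in>vfields (atl K). \<forall>\<xi>\<in>oneforms (atl K).
         - Jp K (Jm K (X, \<xi>)) = (sharp (atl K) (met K) \<xi>, met K X))"

text \<open>From here on the sign \<open>\<plusminus>\<close> is a parameter \<open>s \<in> {1, -1}\<close>.\<close>

definition Lplus where "Lplus K = eigenbundle (atl K) (Jp K)"
definition Lminus where "Lminus K = eigenbundle (atl K) (Jm K)"

definition ell ::
  "('a::{t2_space,second_countable_topology}, 'e::euclidean_space) gk \<Rightarrow> real \<Rightarrow> 'a tt cpx set" where
  "ell K s = (if s = 1 then Lplus K \<inter> Lminus K else Lplus K \<inter> cconj ` Lminus K)"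

definition Lbar where "Lbar K = cconj ` Lplus K"
definition ellbar where "ellbar K s = cconj ` ell K s"

abbreviation cdorfman where
  "cdorfman K \<equiv> cext2 (dorfman (atl K) (gam K))"

definition cplx_str :: "('a, 'e) gk \<Rightarrow> real \<Rightarrow> 'a vf \<Rightarrow> 'a vf" where
  "cplx_str K s X = fst (Jp K (X, scl (\<lambda>_. s) (met K X)))"

text \<open>The projection \<open>X \<mapsto> (X + i I\<^sub>s X)/2\<close> onto \<open>T\<^sup>s\<^sub>0\<^sub>,\<^sub>1M\<close>, and the inverse
  \<open>T\<^sup>s\<^sub>0\<^sub>,\<^sub>1M \<rightarrow> \<ell>\<^sub>s\<close>-bar of the anchor, extended by zero to \<open>T\<^sup>s\<^sub>1\<^sub>,\<^sub>0M\<close>.\<close>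

definition proj01 :: "('a, 'e) gk \<Rightarrow> real \<Rightarrow> 'a vf cpx \<Rightarrow> 'a vf cpx" where
  "proj01 K s X = cext (scl (\<lambda>_. 1/2)) (X + ii (cext (cplx_str K s) X))"

definition lift ::
  "('a::{t2_space,second_countable_topology}, 'e::euclidean_space) gk
     \<Rightarrow> real \<Rightarrow> 'a vf cpx \<Rightarrow> 'a tt cpx" where
  "lift K s X = inv_into (ellbar K s) anchor (proj01 K s X)"

section \<open>Bismut connections and the operators \<open>\<delta>\<close>-bar\<close>

definition levi_civita ::
  "('a::{t2_space,second_countable_topology}, 'e::euclidean_space) atlas
     \<Rightarrow> ('a vf \<Rightarrow> 'a oneform) \<Rightarrow> ('a vf \<Rightarrow> 'a vf \<Rightarrow> 'a vf) \<Rightarrow> bool" where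
  "levi_civita A g nabla \<longleftrightarrow>
      (\<forall>X\<in>vfields A. \<forall>Y\<in>vfields A. nabla X Y \<in> vfields A)
    \<and> (\<forall>f\<in>smooth_fun A. \<forall>X\<in>vfields A. \<forall>X'\<in>vfields A. \<forall>Y\<in>vfields A.
         nabla (scl f X + X') Y = scl f (nabla X Y) + nabla X' Y)
    \<and> (\<forall>X\<in>vfields A. \<forall>Y\<in>vfields A. \<forall>Y'\<in>vfields A. nabla X (Y + Y') = nabla X Y + nabla X Y')
    \<and> (\<forall>f\<in>smooth_fun A. \<forall>X\<in>vfields A. \<forall>Y\<in>vfields A.
         nabla X (scl f Y) = scl (X f) Y + scl f (nabla X Y))
    \<and> (\<forall>X\<in>vfields A. \<forall>Y\<in>vfields A. nabla X Y - nabla Y X = lie X Y)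
    \<and> (\<forall>X\<in>vfields A. \<forall>Y\<in>vfields A. \<forall>Z\<in>vfields A.
         X (g Y Z) = g (nabla X Y) Z + g Y (nabla X Z))"

definition bismut ::
  "('a::{t2_space,second_countable_topology}, 'e::euclidean_space) gk
     \<Rightarrow> ('a vf \<Rightarrow> 'a vf \<Rightarrow> 'a vf) \<Rightarrow> real \<Rightarrow> 'a vf \<Rightarrow> 'a vf \<Rightarrow> 'a vf" where
  "bismut K nabla s X Y =
     nabla X Y + scl (\<lambda>_. s/2) (sharp (atl K) (met K) (contract2 (atl K) X Y (gam K)))"

text \<open>The induced covariant derivative of complex forms of arbitrary degree.\<close>

definition covd_form ::
  "('a vf cpx \<Rightarrow> 'a vf cpx \<Rightarrow> 'a vf cpx) \<Rightarrow> 'a vf cpx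
     \<Rightarrow> ('a vf cpx list \<Rightarrow> 'a cfun) \<Rightarrow> 'a vf cpx list \<Rightarrow> 'a cfun" where
  "covd_form D X \<beta> Ys = cact X (\<beta> Ys) - (\<Sum>j<length Ys. \<beta> (Ys[j := D X (Ys ! j)]))"

text \<open>\<open>dolbeault\<close> is \<open>\<partial>\<close>-bar\<open>\<^sub>s\<close> on \<open>\<Omega>\<^sup>0\<^sup>,\<^sup>p\<^sub>s\<close>, the \<open>(0, p+1)\<close>-part of \<open>d\<close>.  \<open>mixed_dbar\<close> is
  \<open>\<partial>\<close>-bar\<open>\<^sup>s\<close>, the connection of the opposite sign differentiating in the \<open>\<Omega>\<^sup>0\<^sup>,\<^sup>1\<^sub>s\<close>-direction; the
  first argument after the sign is the new covector slot.\<close>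

definition dolbeault ::
  "('a, 'e) gk \<Rightarrow> real \<Rightarrow> ('a vf cpx list \<Rightarrow> 'a cfun) \<Rightarrow> 'a vf cpx list \<Rightarrow> 'a cfun" where
  "dolbeault K s \<alpha> Xs = cartan_diff cact (cext2 lie) \<alpha> (map (proj01 K s) Xs)"

definition mixed_dbar ::
  "('a::{t2_space,second_countable_topology}, 'e::euclidean_space) gk
     \<Rightarrow> ('a vf \<Rightarrow> 'a vf \<Rightarrow> 'a vf) \<Rightarrow> real \<Rightarrow> 'a vf cpx
     \<Rightarrow> ('a vf cpx list \<Rightarrow> 'a cfun) \<Rightarrow> 'a vf cpx list \<Rightarrow> 'a cfun" where
  "mixed_dbar K nabla s X = covd_form (cext2 (bismut K nabla (- s))) (proj01 K s X)"

text \<open>An element of \<open>\<Omega>\<^sup>0\<^sup>,\<^sup>p\<^sub>s \<otimes> \<Omega>\<^sup>0\<^sup>,\<^sup>q\<^sub>-\<^sub>s\<close> takes a list of \<open>p\<close> and a list of \<open>q\<close> vector fields, so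
  \<open>\<alpha> \<and> \<beta>\<close> is \<open>\<lambda>Xs Ys. \<alpha> Xs * \<beta> Ys\<close>.  The slots that the operator differentiates come first for both
  signs; for \<open>s = -1\<close> the factors are thus reordered by graded commutativity.

  \<open>\<delta>\<close>-bar\<open>\<^sub>s = \<partial>\<close>-bar\<open>\<^sub>s + \<partial>\<close>-bar\<open>\<^sup>s\<close> is given in closed form, as \<open>\<partial>\<close>-bar\<open>\<^sub>s\<close> on the \<open>Xs\<close> coupled to
  \<open>\<partial>\<close>-bar\<open>\<^sup>s\<close> on the \<open>Ys\<close>; \<open>delta_form_wedge\<close> below is the defining Leibniz rule.\<close>

definition delta_form ::
  "('a::{t2_space,second_countable_topology}, 'e::euclidean_space) gk
     \<Rightarrow> ('a vf \<Rightarrow> 'a vf \<Rightarrow> 'a vf) \<Rightarrow> real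
     \<Rightarrow> ('a vf cpx list \<Rightarrow> 'a vf cpx list \<Rightarrow> 'a cfun)
     \<Rightarrow> 'a vf cpx list \<Rightarrow> 'a vf cpx list \<Rightarrow> 'a cfun" where
  "delta_form K nabla s \<omega> Xs =
     cartan_diff (covd_form (cext2 (bismut K nabla (- s)))) (cext2 lie) \<omega> (map (proj01 K s) Xs)"

lemma delta_form_wedge:
  fixes K :: "('a::{t2_space,second_countable_topology}, 'e::euclidean_space) gk"
  assumes A: "smooth_atlas (atl K)" and n: "length Xs = Suc p"
    and Xs: "\<And>X. X \<in> set Xs \<Longrightarrow> X \<in> cvfields (atl K) \<and> proj01 K s X = X"
    and Ys: "set Ys \<subseteq> cvfields (atl K)"
    and \<alpha>: "\<And>Zs. set Zs \<subseteq> cvfields (atl K) \<Longrightarrow> \<alpha> Zs \<in> csmooth_fun (atl K)"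
    and \<beta>: "\<And>Zs. set Zs \<subseteq> cvfields (atl K) \<Longrightarrow> \<beta> Zs \<in> csmooth_fun (atl K)"
  shows "delta_form K nabla s (\<lambda>Xs Ys. \<alpha> Xs * \<beta> Ys) Xs Ys =
     dolbeault K s \<alpha> Xs * \<beta> Ys
     + (-1) ^ p * (\<Sum>i\<le>p. (-1) ^ (p - i) * \<alpha> (drop_nth i Xs) * mixed_dbar K nabla s (Xs ! i) \<beta> Ys)"
proof -
  define D where "D = cext2 (bismut K nabla (- s))"
  have mp: "map (proj01 K s) Xs = Xs"
    using Xs by (simp add: map_idI)
  have sub: "set (drop_nth i Xs) \<subseteq> cvfields (atl K)" for i
    using Xs set_take_subset[of i Xs] set_drop_subset[of "Suc i" Xs] by (auto simp: drop_nth_def)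
  have app: "(sum F I) Ys = (\<Sum>i\<in>I. F i Ys)"
    for F :: "nat \<Rightarrow> 'a vf cpx list \<Rightarrow> 'a cfun" and I
    by (induction I rule: infinite_finite_induct) auto
  have pw: "((-1) ^ k * G) Ys = (-1) ^ k * G Ys" for k :: nat and G :: "'a vf cpx list \<Rightarrow> 'a cfun"
    by (induction k) (auto simp: fun_eq_iff)
  have pl: "(F + G) Ys = F Ys + G Ys" for F G :: "'a vf cpx list \<Rightarrow> 'a cfun"
    by simp
  have cov: "covd_form D (Xs ! i) (\<lambda>Ys. \<alpha> (drop_nth i Xs) * \<beta> Ys) Ys
      = cact (Xs ! i) (\<alpha> (drop_nth i Xs)) * \<beta> Ys
        + \<alpha> (drop_nth i Xs) * covd_form D (Xs ! i) \<beta> Ys" if "i < Suc p" for i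
  proof -
    have "Xs ! i \<in> cvfields (atl K)" using that n Xs by auto
    from cact_mult[OF A this \<alpha>[OF sub] \<beta>[OF Ys]] show ?thesis
      by (simp add: covd_form_def sum_distrib_left algebra_simps)
  qed
  have sgn: "(-1::'a cfun) ^ p * (-1) ^ (p - i) = (-1) ^ i" if "i \<le> p" for i
  proof -
    have "(-1::'a cfun) ^ p = (-1) ^ (p - i) * (-1) ^ i"
      using that by (simp only: power_add[symmetric] le_add_diff_inverse2)
    then have "(-1::'a cfun) ^ p * (-1) ^ (p - i) = (-1) ^ (p - i) * ((-1) ^ (p - i) * (-1) ^ i)"
      by (metis mult.commute)
    then show ?thesis
      by (simp only: left_minus_one_mult_self)
  qed
  have "delta_form K nabla s (\<lambda>Xs Ys. \<alpha> Xs * \<beta> Ys) Xs Ys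
      = (\<Sum>i<Suc p. (-1) ^ i * covd_form D (Xs ! i) (\<lambda>Ys. \<alpha> (drop_nth i Xs) * \<beta> Ys) Ys)
        + (\<Sum>j<Suc p. \<Sum>i<j. (-1) ^ (i + j)
             * (\<alpha> (cext2 lie (Xs ! i) (Xs ! j) # drop_nth i (drop_nth j Xs)) * \<beta> Ys))"
    unfolding delta_form_def cartan_diff_def mp n D_def[symmetric]
    by (simp only: pl app pw)
  also have "(\<Sum>i<Suc p. (-1) ^ i * covd_form D (Xs ! i) (\<lambda>Ys. \<alpha> (drop_nth i Xs) * \<beta> Ys) Ys)
      = (\<Sum>i<Suc p. (-1) ^ i * cact (Xs ! i) (\<alpha> (drop_nth i Xs))) * \<beta> Ys
        + (\<Sum>i<Suc p. (-1) ^ i * (\<alpha> (drop_nth i Xs) * covd_form D (Xs ! i) \<beta> Ys))"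
    unfolding sum_distrib_right sum.distrib[symmetric]
    by (intro sum.cong refl) (simp only: cov lessThan_iff distrib_left mult.assoc)
  also have "(\<Sum>i<Suc p. (-1) ^ i * (\<alpha> (drop_nth i Xs) * covd_form D (Xs ! i) \<beta> Ys))
      = (-1) ^ p * (\<Sum>i\<le>p. (-1) ^ (p - i) * \<alpha> (drop_nth i Xs) * mixed_dbar K nabla s (Xs ! i) \<beta> Ys)"
    unfolding sum_distrib_left lessThan_Suc_atMost
  proof (intro sum.cong refl)
    fix i assume "i \<in> {..p}"
    then have i: "i \<le> p" by simp
    then have "proj01 K s (Xs ! i) = Xs ! i" using Xs n by auto
    then have "mixed_dbar K nabla s (Xs ! i) \<beta> Ys = covd_form D (Xs ! i) \<beta> Ys"
      by (simp add: mixed_dbar_def D_def)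
    then show "(-1) ^ i * (\<alpha> (drop_nth i Xs) * covd_form D (Xs ! i) \<beta> Ys)
        = (-1) ^ p * ((-1) ^ (p - i) * \<alpha> (drop_nth i Xs) * mixed_dbar K nabla s (Xs ! i) \<beta> Ys)"
      by (simp only: mult.assoc[symmetric] sgn[OF i])
  qed
  finally show ?thesis
    unfolding dolbeault_def cartan_diff_def mp n
    by (simp only: sum_distrib_right distrib_right mult.assoc add.assoc add.commute add.left_commute)
qed

text \<open>The same operator on sections of \<open>\<Lambda>\<^sup>p \<ell>\<^sub>s\<close>-bar\<open>\<^sup>* \<otimes> \<Lambda>\<^sup>q \<ell>\<^sub>-\<^sub>s\<close>-bar\<open>\<^sup>*\<close>, transported along the anchor
  isomorphisms.\<close>

definition delta ::
  "('a::{t2_space,second_countable_topology}, 'e::euclidean_space) gk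
     \<Rightarrow> ('a vf \<Rightarrow> 'a vf \<Rightarrow> 'a vf) \<Rightarrow> real
     \<Rightarrow> ('a tt cpx list \<Rightarrow> 'a tt cpx list \<Rightarrow> 'a cfun)
     \<Rightarrow> 'a tt cpx list \<Rightarrow> 'a tt cpx list \<Rightarrow> 'a cfun" where
  "delta K nabla s \<omega> us vs =
     delta_form K nabla s (\<lambda>Xs Ys. \<omega> (map (lift K s) Xs) (map (lift K (- s)) Ys))
       (map anchor us) (map anchor vs)"

definition ellbar_dual ::
  "('a::{t2_space,second_countable_topology}, 'e::euclidean_space) gk
     \<Rightarrow> real \<Rightarrow> ('a tt cpx \<Rightarrow> 'a cfun) set" where
  "ellbar_dual K s = {\<beta>.
      (\<forall>u\<in>ellbar K s. \<beta> u \<in> csmooth_fun (atl K))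
    \<and> (\<forall>f\<in>csmooth_fun (atl K). \<forall>u\<in>ellbar K s. \<forall>v\<in>ellbar K s.
         \<beta> (cttscl f u + v) = f * \<beta> u + \<beta> v)
    \<and> (\<forall>u. u \<notin> ellbar K s \<longrightarrow> \<beta> u = 0)}"

text \<open>A section of \<open>\<ell>\<^sub>-\<^sub>s\<close>-bar\<open>\<^sup>*\<close> as an element of bidegree \<open>p = 0\<close>, \<open>q = 1\<close>.\<close>

definition deg01 :: "('a tt cpx \<Rightarrow> 'a cfun) \<Rightarrow> 'a tt cpx list \<Rightarrow> 'a tt cpx list \<Rightarrow> 'a cfun" where
  "deg01 \<beta> us vs = \<beta> (hd vs)"

section \<open>Holomorphic reduction\<close>

text \<open>Sections of \<open>\<A>\<^sub>s\<close>, the quotient of \<open>L\<^sub>+\<close>-bar by \<open>\<ell>\<^sub>s\<close>-bar, are cosets of sections.\<close>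

definition cls ::
  "('a::{t2_space,second_countable_topology}, 'e::euclidean_space) gk
     \<Rightarrow> real \<Rightarrow> 'a tt cpx \<Rightarrow> 'a tt cpx set" where
  "cls K s u = {u + v | v. v \<in> ellbar K s}"

definition Aquot ::
  "('a::{t2_space,second_countable_topology}, 'e::euclidean_space) gk
     \<Rightarrow> real \<Rightarrow> 'a tt cpx set set" where
  "Aquot K s = cls K s ` Lbar K"

text \<open>The value on a class is independent of the representative, so the union is over equal classes.\<close>

definition dbar_A ::
  "('a::{t2_space,second_countable_topology}, 'e::euclidean_space) gk
     \<Rightarrow> real \<Rightarrow> 'a vf cpx \<Rightarrow> 'a tt cpx set \<Rightarrow> 'a tt cpx set" where
  "dbar_A K s X c = (\<Union>u\<in>c. cls K s (cdorfman K (lift K s X) u))"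

definition A_dual ::
  "('a::{t2_space,second_countable_topology}, 'e::euclidean_space) gk
     \<Rightarrow> real \<Rightarrow> ('a tt cpx set \<Rightarrow> 'a cfun) set" where
  "A_dual K s = {\<mu>.
      (\<forall>c\<in>Aquot K s. \<mu> c \<in> csmooth_fun (atl K))
    \<and> (\<forall>f\<in>csmooth_fun (atl K). \<forall>u\<in>Lbar K. \<forall>v\<in>Lbar K.
         \<mu> (cls K s (cttscl f u + v)) = f * \<mu> (cls K s u) + \<mu> (cls K s v))
    \<and> (\<forall>c. c \<notin> Aquot K s \<longrightarrow> \<mu> c = 0)}"

definition dbar_A_dual ::
  "('a::{t2_space,second_countable_topology}, 'e::euclidean_space) gk
     \<Rightarrow> real \<Rightarrow> 'a vf cpx \<Rightarrow> ('a tt cpx set \<Rightarrow> 'a cfun) \<Rightarrow> 'a tt cpx set \<Rightarrow> 'a cfun" where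
  "dbar_A_dual K s X \<mu> c = cact X (\<mu> c) - \<mu> (dbar_A K s X c)"

text \<open>The transpose of the natural isomorphism \<open>cls K s\<close> from \<open>\<ell>\<^sub>-\<^sub>s\<close>-bar to \<open>\<A>\<^sub>s\<close>.\<close>

definition cls_transpose ::
  "('a::{t2_space,second_countable_topology}, 'e::euclidean_space) gk
     \<Rightarrow> real \<Rightarrow> ('a tt cpx set \<Rightarrow> 'a cfun) \<Rightarrow> 'a tt cpx \<Rightarrow> 'a cfun" where
  "cls_transpose K s \<mu> = (\<lambda>u. if u \<in> ellbar K (- s) then \<mu> (cls K s u) else 0)"

end

(*  The s-eigenbundle of G = -J_+ J_- is the graph of s g, so sections of ellbar_s and ellbar_{-s} are
    X + s g X and Y - s g Y.  For real X and Y, the Koszul formula shows that the anchor of the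
    (-s)-component of the Dorfman bracket (X + s g X) * (Y - s g Y) is the Bismut derivative
    nabla^{-s}_X Y.  For sections of ellbar_s and ellbar_{-s} the bracket lies in the bundle
    L_+-bar by involutivity, so its class in A_s is exactly that component.  Changing the
    representative of a class adds the bracket of two sections of ellbar_s, which stays in ellbar_s,
    since both L_+-bar and the eigenbundle of J_- in question are involutive.  *)

theory Submission
  imports Defs
begin

section \<open>Sections of tensor bundles\<close>

text \<open>The Koszul computation is real, whereas the operators act on complex sections, and
  \<open>lift\<close> discards the (1,0)-part for I_{-s}; the comparison must therefore show that
  the Bismut derivative has none. Writing L_+-bar as the set of sections a + i J_+ a settles both
  points. A bracket that stays in L_+-bar is again of this form, and J_+ commutes with the
  projections to the eigenbundles of G, so projecting gives Z + i I_{-s} Z, which is of type (0,1).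
  The factor 1/2 in front of the three-form in the connection is the 1/2 of the projection (1 - s
  G)/2. The inverse of g is given by a choice function: definiteness makes g injective, and
  surjectivity has to be extracted from G^2 = 1.\<close>

lemma smooth_fun_0: "0 \<in> smooth_fun A"
  using smooth_fun_const[of 0] by (simp add: zero_fun_def)

lemma smooth_fun_1: "1 \<in> smooth_fun A"
  using smooth_fun_const[of 1] by (simp add: one_fun_def)

lemma smooth_fun_uminus:
  assumes "smooth_atlas A" "f \<in> smooth_fun A"
  shows "- f \<in> smooth_fun A"
proof -
  have "(\<lambda>_. -1) * f = - f"
    by (simp add: fun_eq_iff)
  then show ?thesis
    using smooth_fun_mult[OF assms(1) smooth_fun_const assms(2), of "-1"] by simp
qed

lemma smooth_fun_diff:
  assumes "smooth_atlas A" "f \<in> smooth_fun A" "h \<in> smooth_fun A"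
  shows "f - h \<in> smooth_fun A"
  using smooth_fun_add[OF assms(1,2) smooth_fun_uminus[OF assms(1,3)]] by simp

lemma scl_apply: "scl f t x = f * t x"
  by (simp add: scl_def)

lemma scl_simps [simp]: "scl 1 s = s" "scl 0 s = 0" "scl f 0 = 0" "scl f (scl h s) = scl (f * h) s"
  by (simp_all add: scl_def fun_eq_iff)

lemma scl_add: "scl f (s + t) = scl f s + scl f t"
  and scl_diff: "scl f (s - t) = scl f s - scl f t"
  and scl_uminus: "scl f (- s) = - scl f s"
  and scl_minus_one: "scl (- 1) s = - s"
  by (simp_all add: scl_def fun_eq_iff algebra_simps)

lemma ttscl_simps: "ttscl 1 a = a" "ttscl (- 1) a = - a"
  by (simp_all add: ttscl_def scl_minus_one prod_eq_iff)

lemma fun_const_simps: "(\<lambda>_. 1) = (1 :: 'a rfun)" "(\<lambda>_. - 1) = (- 1 :: 'a rfun)"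
  by (simp_all add: fun_eq_iff)

context
  fixes A :: "('a::{t2_space,second_countable_topology}, 'e::euclidean_space) atlas"
  assumes A: "smooth_atlas A"
begin

text \<open>Smoothness of \<open>f\<close> is not asked for: off the smooth functions a vector field
  takes the value 0, which is smooth. This spares side conditions when derivations are
  iterated.\<close>

lemma vfield_smooth: "X \<in> vfields A \<Longrightarrow> X f \<in> smooth_fun A"
  by (cases "f \<in> smooth_fun A") (auto simp: vfields_def smooth_fun_0)

lemma vfield_add:
  "X \<in> vfields A \<Longrightarrow> f \<in> smooth_fun A \<Longrightarrow> h \<in> smooth_fun A \<Longrightarrow> X (f + h) = X f + X h"
  by (simp add: vfields_def)

lemma vfield_const_mult:
  "X \<in> vfields A \<Longrightarrow> f \<in> smooth_fun A \<Longrightarrow> X ((\<lambda>_. c) * f) = (\<lambda>_. c) * X f"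
  by (simp add: vfields_def)

lemma vfield_mult:
  "X \<in> vfields A \<Longrightarrow> f \<in> smooth_fun A \<Longrightarrow> h \<in> smooth_fun A \<Longrightarrow> X (f * h) = X f * h + f * X h"
  by (simp add: vfields_def)

lemma vfield_outside: "X \<in> vfields A \<Longrightarrow> f \<notin> smooth_fun A \<Longrightarrow> X f = 0"
  by (simp add: vfields_def)

lemma vfield_zero: "X \<in> vfields A \<Longrightarrow> X 0 = 0"
  using vfield_add[of X 0 0] by (simp add: smooth_fun_0)

lemma vfield_const:
  assumes "X \<in> vfields A"
  shows "X (\<lambda>_. c) = 0"
proof -
  have "X 1 = X 1 * 1 + 1 * X 1"
    using vfield_mult[OF assms smooth_fun_1 smooth_fun_1] by simp
  then have "X 1 = 0"
    by (simp add: fun_eq_iff)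
  moreover have "(\<lambda>_. c) * 1 = (\<lambda>_. c)"
    by (simp add: fun_eq_iff)
  ultimately show ?thesis
    using vfield_const_mult[OF assms smooth_fun_1, of c] by simp
qed

lemma vfield_uminus: "X \<in> vfields A \<Longrightarrow> f \<in> smooth_fun A \<Longrightarrow> X (- f) = - X f"
  using vfield_const_mult[of X f "-1"] by (simp add: fun_const_simps)

lemma vfields_add: "X \<in> vfields A \<Longrightarrow> Y \<in> vfields A \<Longrightarrow> X + Y \<in> vfields A"
  by (simp add: vfields_def smooth_fun_add[OF A] algebra_simps)

lemma vfields_scl: "f \<in> smooth_fun A \<Longrightarrow> X \<in> vfields A \<Longrightarrow> scl f X \<in> vfields A"
  by (simp add: vfields_def scl_def smooth_fun_mult[OF A] algebra_simps)

lemma vfields_uminus: "X \<in> vfields A \<Longrightarrow> - X \<in> vfields A"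
  by (simp add: vfields_def smooth_fun_uminus[OF A] algebra_simps)

lemma vfields_zero: "0 \<in> vfields A"
  by (simp add: vfields_def smooth_fun_0)

lemma vfields_diff: "X \<in> vfields A \<Longrightarrow> Y \<in> vfields A \<Longrightarrow> X - Y \<in> vfields A"
  using vfields_add[of X "- Y"] by (simp add: vfields_uminus)

lemma vfields_lie:
  assumes "X \<in> vfields A" "Y \<in> vfields A"
  shows "lie X Y \<in> vfields A"
proof -
  note sm = smooth_fun_add[OF A] smooth_fun_mult[OF A] smooth_fun_diff[OF A] smooth_fun_const
    vfield_smooth[OF assms(1)] vfield_smooth[OF assms(2)]
  note L = vfield_add vfield_mult vfield_const vfield_outside vfield_zero
  show ?thesis
    unfolding vfields_def mem_Collect_eq lie_def
    by (simp add: sm L[OF assms(1)] L[OF assms(2)] algebra_simps)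
qed

lemma lie_add_left:
  assumes "X \<in> vfields A" "X' \<in> vfields A" "Y \<in> vfields A"
  shows "lie (X + X') Y = lie X Y + lie X' Y"
  using assms by (simp add: lie_def fun_eq_iff[where g = "_ + _"] vfield_add vfield_smooth)

lemma lie_swap: "lie X Y = - lie Y X"
  by (simp add: lie_def fun_eq_iff)

lemma lie_add_right:
  assumes "X \<in> vfields A" "Y \<in> vfields A" "Y' \<in> vfields A"
  shows "lie X (Y + Y') = lie X Y + lie X Y'"
  using lie_add_left[OF assms(2,3,1)] by (simp add: lie_swap[of X])

section \<open>One-forms and sections of TM + T*M\<close>

lemma oneform_smooth: "\<xi> \<in> oneforms A \<Longrightarrow> \<xi> X \<in> smooth_fun A"
  by (cases "X \<in> vfields A") (auto simp: oneforms_def smooth_fun_0)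

lemma oneform_add:
  assumes "\<xi> \<in> oneforms A" "X \<in> vfields A" "Y \<in> vfields A"
  shows "\<xi> (X + Y) = \<xi> X + \<xi> Y"
proof -
  have "\<xi> (scl 1 X + Y) = 1 * \<xi> X + \<xi> Y"
    using assms smooth_fun_1 unfolding oneforms_def by blast
  then show ?thesis by simp
qed

lemma oneform_zero: "\<xi> \<in> oneforms A \<Longrightarrow> \<xi> 0 = 0"
  using oneform_add[of \<xi> 0 0] by (simp add: vfields_zero)

lemma oneform_scl:
  assumes "\<xi> \<in> oneforms A" "f \<in> smooth_fun A" "X \<in> vfields A"
  shows "\<xi> (scl f X) = f * \<xi> X"
proof -
  have "\<xi> (scl f X + 0) = f * \<xi> X + \<xi> 0"
    using assms vfields_zero unfolding oneforms_def by blast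
  then show ?thesis
    using oneform_zero[OF assms(1)] by simp
qed

lemma oneform_uminus: "\<xi> \<in> oneforms A \<Longrightarrow> X \<in> vfields A \<Longrightarrow> \<xi> (- X) = - \<xi> X"
  using oneform_add[of \<xi> X "- X"] oneform_zero[of \<xi>] vfields_uminus[of X]
  by (metis add.right_inverse minus_unique)

lemma oneform_diff:
  "\<xi> \<in> oneforms A \<Longrightarrow> X \<in> vfields A \<Longrightarrow> Y \<in> vfields A \<Longrightarrow> \<xi> (X - Y) = \<xi> X - \<xi> Y"
  using oneform_add[of \<xi> X "- Y"] oneform_uminus[of \<xi> Y] vfields_uminus by simp

lemma oneform_outside: "\<xi> \<in> oneforms A \<Longrightarrow> X \<notin> vfields A \<Longrightarrow> \<xi> X = 0"
  by (simp add: oneforms_def)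

lemma oneforms_add: "\<xi> \<in> oneforms A \<Longrightarrow> \<eta> \<in> oneforms A \<Longrightarrow> \<xi> + \<eta> \<in> oneforms A"
  by (simp add: oneforms_def smooth_fun_add[OF A] algebra_simps)

lemma oneforms_scl: "f \<in> smooth_fun A \<Longrightarrow> \<xi> \<in> oneforms A \<Longrightarrow> scl f \<xi> \<in> oneforms A"
  by (simp add: oneforms_def scl_def smooth_fun_mult[OF A] algebra_simps)

lemma oneforms_uminus: "\<xi> \<in> oneforms A \<Longrightarrow> - \<xi> \<in> oneforms A"
  by (simp add: oneforms_def smooth_fun_uminus[OF A] algebra_simps)

lemma oneforms_zero: "0 \<in> oneforms A"
  by (simp add: oneforms_def smooth_fun_0)

lemma oneform_eqI:
  assumes "\<xi> \<in> oneforms A" "\<eta> \<in> oneforms A" "\<And>Z. Z \<in> vfields A \<Longrightarrow> \<xi> Z = \<eta> Z"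
  shows "\<xi> = \<eta>"
  using assms oneform_outside by (metis ext)

lemma ttsections_add: "a \<in> ttsections A \<Longrightarrow> b \<in> ttsections A \<Longrightarrow> a + b \<in> ttsections A"
  by (auto simp: ttsections_def vfields_add oneforms_add)

lemma ttsections_uminus: "a \<in> ttsections A \<Longrightarrow> - a \<in> ttsections A"
  by (auto simp: ttsections_def vfields_uminus oneforms_uminus)

lemma ttsections_diff: "a \<in> ttsections A \<Longrightarrow> b \<in> ttsections A \<Longrightarrow> a - b \<in> ttsections A"
  using ttsections_add[of a "- b"] by (simp add: ttsections_uminus)

lemma ttsections_zero: "0 \<in> ttsections A"
  by (auto simp: ttsections_def vfields_zero oneforms_zero zero_prod_def)

lemma ttsections_ttscl: "f \<in> smooth_fun A \<Longrightarrow> a \<in> ttsections A \<Longrightarrow> ttscl f a \<in> ttsections A"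
  by (auto simp: ttsections_def ttscl_def vfields_scl oneforms_scl)

section \<open>Contractions of the three-form\<close>

lemma kforms3_add:
  assumes \<gamma>: "\<gamma> \<in> kforms A 3" and V: "X \<in> vfields A" "X' \<in> vfields A" "Y \<in> vfields A" "Z \<in> vfields A"
  shows "\<gamma> [X + X', Y, Z] = \<gamma> [X, Y, Z] + \<gamma> [X', Y, Z]"
    and "\<gamma> [Y, X + X', Z] = \<gamma> [Y, X, Z] + \<gamma> [Y, X', Z]"
    and "\<gamma> [Y, Z, X + X'] = \<gamma> [Y, Z, X] + \<gamma> [Y, Z, X']"
proof -
  have *: "\<gamma> (Ws[i := scl 1 X + X']) = 1 * \<gamma> (Ws[i := X]) + \<gamma> (Ws[i := X'])"
    if "length Ws = 3" "set Ws \<subseteq> vfields A" "i < 3" for Ws i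
    using \<gamma> that V smooth_fun_1 unfolding kforms_def by blast
  \<comment> \<open>Slot \<open>i\<close> of the list is overwritten, so its original entry is only
    a filler in \<open>vfields A\<close>.\<close>
  from *[of "[Y, Y, Z]" 0] *[of "[Y, Y, Z]" 1] *[of "[Y, Z, Z]" 2] V
  show "\<gamma> [X + X', Y, Z] = \<gamma> [X, Y, Z] + \<gamma> [X', Y, Z]"
    "\<gamma> [Y, X + X', Z] = \<gamma> [Y, X, Z] + \<gamma> [Y, X', Z]"
    "\<gamma> [Y, Z, X + X'] = \<gamma> [Y, Z, X] + \<gamma> [Y, Z, X']"
    by (simp_all add: numeral_2_eq_2)
qed

lemma kforms3_scl:
  assumes \<gamma>: "\<gamma> \<in> kforms A 3" and V: "X \<in> vfields A" "Y \<in> vfields A" "Z \<in> vfields A"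
    and f: "f \<in> smooth_fun A"
  shows "\<gamma> [X, Y, scl f Z] = f * \<gamma> [X, Y, Z]"
proof -
  have "\<gamma> ([X, Y, Z][2 := scl f Z + 0]) = f * \<gamma> ([X, Y, Z][2 := Z]) + \<gamma> ([X, Y, Z][2 := 0])"
  proof -
    have "length [X, Y, Z] = 3" "set [X, Y, Z] \<subseteq> vfields A" "(2::nat) < 3"
      using V by auto
    then show ?thesis
      using \<gamma> V(3) f vfields_zero unfolding kforms_def by blast
  qed
  moreover have "\<gamma> [X, Y, 0] = 0"
    using kforms3_add(3)[OF \<gamma> vfields_zero vfields_zero V(1,2)] by simp
  ultimately show ?thesis by (simp add: numeral_2_eq_2)
qed

lemma contract2_oneform:
  assumes \<gamma>: "\<gamma> \<in> kforms A 3" and V: "X \<in> vfields A" "Y \<in> vfields A"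
  shows "contract2 A X Y \<gamma> \<in> oneforms A"
proof -
  have "\<gamma> [Y, X, Z] \<in> smooth_fun A" if "Z \<in> vfields A" for Z
    using \<gamma> V that unfolding kforms_def by (auto simp: numeral_3_eq_3)
  then show ?thesis
    unfolding oneforms_def contract2_def as_oneform_def
    by (auto simp: vfields_add vfields_scl kforms3_add(3)[OF \<gamma> _ _ V(2,1)] kforms3_scl[OF \<gamma> V(2,1)])
qed

section \<open>Lie derivative, exterior derivative and the Dorfman bracket\<close>

lemma lie_scl_right:
  assumes X: "X \<in> vfields A" and Y: "Y \<in> vfields A" and f: "f \<in> smooth_fun A"
  shows "lie X (scl f Y) = scl (X f) Y + scl f (lie X Y)"
  using vfield_mult[OF X f vfield_smooth[OF Y]]
  by (intro ext) (simp add: lie_def scl_def algebra_simps)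

text \<open>Tensoriality: the Leibniz term \<open>X f * \<eta> Z\<close> in the derivative of
  \<eta>(f Z) cancels the one contributed by the bracket [X, f Z].\<close>

lemma lie_oneform_oneform:
  assumes X: "X \<in> vfields A" and \<eta>: "\<eta> \<in> oneforms A"
  shows "lie_oneform A X \<eta> \<in> oneforms A"
proof -
  have sm: "X (\<eta> Z) - \<eta> (lie X Z) \<in> smooth_fun A" for Z
    by (intro smooth_fun_diff[OF A] vfield_smooth[OF X] oneform_smooth[OF \<eta>])
  have lin: "X (\<eta> (scl f Z + Z')) - \<eta> (lie X (scl f Z + Z'))
      = f * (X (\<eta> Z) - \<eta> (lie X Z)) + (X (\<eta> Z') - \<eta> (lie X Z'))"
    if f: "f \<in> smooth_fun A" and Z: "Z \<in> vfields A" "Z' \<in> vfields A" for f Z Z'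
  proof -
    note V = vfields_scl[OF f Z(1)] vfields_lie[OF X Z(1)] vfields_lie[OF X Z(2)]
    note V' = vfields_scl[OF f V(2)] vfields_scl[OF vfield_smooth[OF X] Z(1)]
    have "X (\<eta> (scl f Z + Z')) = X f * \<eta> Z + f * X (\<eta> Z) + X (\<eta> Z')"
      using vfield_add[OF X smooth_fun_mult[OF A f oneform_smooth[OF \<eta>]] oneform_smooth[OF \<eta>]]
        vfield_mult[OF X f oneform_smooth[OF \<eta>]]
      by (simp only: oneform_add[OF \<eta> V(1) Z(2)] oneform_scl[OF \<eta> f Z(1)])
    moreover have "\<eta> (lie X (scl f Z + Z')) = X f * \<eta> Z + f * \<eta> (lie X Z) + \<eta> (lie X Z')"
      by (simp only: lie_add_right[OF X V(1) Z(2)] lie_scl_right[OF X Z(1) f]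
          oneform_add[OF \<eta> vfields_add[OF V'(2,1)] V(3)] oneform_add[OF \<eta> V'(2,1)]
          oneform_scl[OF \<eta> f V(2)] oneform_scl[OF \<eta> vfield_smooth[OF X] Z(1)])
    ultimately show ?thesis by (simp add: algebra_simps)
  qed
  show ?thesis
    unfolding oneforms_def lie_oneform_def as_oneform_def
    by (simp add: sm lin vfields_add vfields_scl)
qed

text \<open>By Cartan's formula this is the Lie derivative of \<xi> along Y minus the exact form
  d(\<xi>(Y)), and the latter is visibly tensorial.\<close>

lemma contract_d_oneform:
  assumes Y: "Y \<in> vfields A" and \<xi>: "\<xi> \<in> oneforms A"
  shows "contract_d A Y \<xi> \<in> oneforms A"
proof -
  have "as_oneform A (\<lambda>Z. - Z (\<xi> Y)) \<in> oneforms A"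
    by (simp add: oneforms_def as_oneform_def vfields_add vfields_scl vfield_smooth
        oneform_smooth[OF \<xi>] smooth_fun_uminus[OF A] scl_apply)
  moreover have "contract_d A Y \<xi> = lie_oneform A Y \<xi> + as_oneform A (\<lambda>Z. - Z (\<xi> Y))"
    by (simp add: contract_d_def lie_oneform_def as_oneform_def fun_eq_iff)
  ultimately show ?thesis
    using oneforms_add[OF lie_oneform_oneform[OF Y \<xi>]] by simp
qed

lemma dorfman_ttsections:
  assumes \<gamma>: "\<gamma> \<in> kforms A 3" and "a \<in> ttsections A" "b \<in> ttsections A"
  shows "dorfman A \<gamma> a b \<in> ttsections A"
proof -
  have V: "fst a \<in> vfields A" "fst b \<in> vfields A" "snd a \<in> oneforms A" "snd b \<in> oneforms A"
    using assms by (auto simp: ttsections_def)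
  have "lie_oneform A (fst a) (snd b) + - contract_d A (fst b) (snd a)
      + contract2 A (fst a) (fst b) \<gamma> \<in> oneforms A"
    by (intro oneforms_add oneforms_uminus lie_oneform_oneform contract_d_oneform
        contract2_oneform[OF \<gamma>] V)
  then show ?thesis
    by (simp add: dorfman_def ttsections_def vfields_lie V)
qed

text \<open>The bracket is not linear over functions. Additivity in each argument, with the sign
  rules that it yields, is what computing with the complex extension \<open>cext2\<close> calls
  for.\<close>

lemma dorfman_add_right:
  assumes \<gamma>: "\<gamma> \<in> kforms A 3"
    and "a \<in> ttsections A" "b \<in> ttsections A" "b' \<in> ttsections A"
  shows "dorfman A \<gamma> a (b + b') = dorfman A \<gamma> a b + dorfman A \<gamma> a b'"
proof -
  obtain X \<xi> Y \<eta> Y' \<eta>' where e: "a = (X, \<xi>)" "b = (Y, \<eta>)" "b' = (Y', \<eta>')"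
    by (cases a, cases b, cases b')
  then have V: "X \<in> vfields A" "Y \<in> vfields A" "Y' \<in> vfields A"
    and W: "\<xi> \<in> oneforms A" "\<eta> \<in> oneforms A" "\<eta>' \<in> oneforms A"
    using assms by (auto simp: ttsections_def)
  have "snd (dorfman A \<gamma> a (b + b')) Z = snd (dorfman A \<gamma> a b + dorfman A \<gamma> a b') Z" for Z
  proof (cases "Z \<in> vfields A")
    case True
    note add = lie_add_left[OF V(2,3) True] kforms3_add(1)[OF \<gamma> V(2,3,1) True]
      oneform_add[OF W(1) vfields_lie[OF V(2) True] vfields_lie[OF V(3) True]]
      oneform_add[OF W(1) V(2,3)]
      vfield_add[OF V(1) oneform_smooth[OF W(2)] oneform_smooth[OF W(3)]]
      vfield_add[OF True oneform_smooth[OF W(1)] oneform_smooth[OF W(1)]]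
    show ?thesis
      by (simp only: add dorfman_def e fst_conv snd_conv fst_add snd_add plus_fun_apply fun_diff_def
          lie_oneform_def contract_d_def contract2_def as_oneform_def True if_True)
        (simp add: fun_eq_iff)
  next
    case False
    then show ?thesis
      by (simp add: dorfman_def lie_oneform_def contract_d_def contract2_def as_oneform_def)
  qed
  then show ?thesis
    by (intro prod_eqI ext) (simp_all add: dorfman_def e lie_add_left lie_add_right V)
qed

lemma dorfman_add_left:
  assumes \<gamma>: "\<gamma> \<in> kforms A 3"
    and "a \<in> ttsections A" "a' \<in> ttsections A" "b \<in> ttsections A"
  shows "dorfman A \<gamma> (a + a') b = dorfman A \<gamma> a b + dorfman A \<gamma> a' b"
proof -
  obtain X \<xi> Y \<eta> X' \<xi>' where e: "a = (X, \<xi>)" "b = (Y, \<eta>)" "a' = (X', \<xi>')"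
    by (cases a, cases b, cases a')
  then have V: "X \<in> vfields A" "Y \<in> vfields A" "X' \<in> vfields A"
    and W: "\<xi> \<in> oneforms A" "\<eta> \<in> oneforms A" "\<xi>' \<in> oneforms A"
    using assms by (auto simp: ttsections_def)
  have "snd (dorfman A \<gamma> (a + a') b) Z = snd (dorfman A \<gamma> a b + dorfman A \<gamma> a' b) Z" for Z
  proof (cases "Z \<in> vfields A")
    case True
    note add = lie_add_left[OF V(1,3) True] kforms3_add(2)[OF \<gamma> V(1,3,2) True]
      oneform_add[OF W(2) vfields_lie[OF V(1) True] vfields_lie[OF V(3) True]]
      vfield_add[OF V(2) oneform_smooth[OF W(1)] oneform_smooth[OF W(3)]]
      vfield_add[OF True oneform_smooth[OF W(1)] oneform_smooth[OF W(3)]]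
    show ?thesis
      by (simp only: add dorfman_def e fst_conv snd_conv fst_add snd_add plus_fun_apply fun_diff_def
          lie_oneform_def contract_d_def contract2_def as_oneform_def True if_True)
        (simp add: fun_eq_iff)
  next
    case False
    then show ?thesis
      by (simp add: dorfman_def lie_oneform_def contract_d_def contract2_def as_oneform_def)
  qed
  then show ?thesis
    by (intro prod_eqI ext) (simp_all add: dorfman_def e lie_add_left lie_add_right V)
qed

lemma dorfman_uminus_right:
  assumes "\<gamma> \<in> kforms A 3" "a \<in> ttsections A" "b \<in> ttsections A"
  shows "dorfman A \<gamma> a (- b) = - dorfman A \<gamma> a b"
proof -
  have "dorfman A \<gamma> a 0 = 0"
    using dorfman_add_right[OF assms(1,2) ttsections_zero ttsections_zero] by simp
  then show ?thesis
    using dorfman_add_right[OF assms ttsections_uminus[OF assms(3)]]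
    by (simp add: eq_neg_iff_add_eq_0 add.commute)
qed

lemma dorfman_uminus_left:
  assumes "\<gamma> \<in> kforms A 3" "a \<in> ttsections A" "b \<in> ttsections A"
  shows "dorfman A \<gamma> (- a) b = - dorfman A \<gamma> a b"
proof -
  have "dorfman A \<gamma> 0 b = 0"
    using dorfman_add_left[OF assms(1) ttsections_zero ttsections_zero assms(3)] by simp
  then show ?thesis
    using dorfman_add_left[OF assms(1,2) ttsections_uminus[OF assms(2)] assms(3)]
    by (simp add: eq_neg_iff_add_eq_0 add.commute)
qed

end

section \<open>Conjugate bundles\<close>

lemma cconj_cconj [simp]: "cconj (cconj u) = (u :: 'v::ab_group_add cpx)"
  by (simp add: cconj_def)

lemma inj_cconj: "inj (cconj :: 'v::ab_group_add cpx \<Rightarrow> _)"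
  by (metis cconj_cconj injI)

text \<open>The bracket is the complexification of a real one, so conjugation only inserts signs,
  which can be pulled out of either argument.\<close>

lemma cconj_dorfman:
  assumes A: "smooth_atlas A" and \<gamma>: "\<gamma> \<in> kforms A 3"
    and "u \<in> cttsections A" "v \<in> cttsections A"
  shows "cext2 (dorfman A \<gamma>) (cconj u) (cconj v) = cconj (cext2 (dorfman A \<gamma>) u v)"
  using assms(3,4)
  by (simp add: cconj_def cext2_def cttsections_def ttsections_uminus[OF A]
      dorfman_uminus_left[OF A \<gamma>] dorfman_uminus_right[OF A \<gamma>])

lemma eigenbundle_cconj_closed:
  assumes A: "smooth_atlas A" and \<gamma>: "\<gamma> \<in> kforms A 3" and J: "generalized_complex A \<gamma> J"
    and u: "u \<in> cconj ` eigenbundle A J" and v: "v \<in> cconj ` eigenbundle A J"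
  shows "cext2 (dorfman A \<gamma>) u v \<in> cconj ` eigenbundle A J"
proof -
  obtain u' v' where *: "u' \<in> eigenbundle A J" "u = cconj u'" "v' \<in> eigenbundle A J" "v = cconj v'"
    using u v by auto
  then have "cext2 (dorfman A \<gamma>) u v = cconj (cext2 (dorfman A \<gamma>) u' v')"
    using cconj_dorfman[OF A \<gamma>] by (auto simp: eigenbundle_def)
  then show ?thesis
    using J * by (auto simp: generalized_complex_def)
qed

section \<open>The splitting of a generalized Kaehler manifold\<close>

lemma scl_const_const: "scl (\<lambda>_. c) (scl (\<lambda>_. d) t) = scl (\<lambda>_. c * d) t"
  by (simp add: scl_def fun_eq_iff)

lemma scl_half_double: "scl (\<lambda>_. 1/2) (2 * t) = t"
  by (simp only: mult_2) (simp add: scl_def fun_eq_iff)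

locale gkaehler =
  fixes K :: "('a::{t2_space,second_countable_topology}, 'e::euclidean_space) gk"
  assumes gk: "generalized_kaehler K"
begin

abbreviation V where "V \<equiv> vfields (atl K)"
abbreviation W where "W \<equiv> oneforms (atl K)"
abbreviation TT where "TT \<equiv> ttsections (atl K)"
abbreviation J where "J \<equiv> Jp K"
abbreviation g where "g \<equiv> met K"
abbreviation sh where "sh \<equiv> sharp (atl K) (met K)"
abbreviation I where "I \<equiv> cplx_str K"

lemma atlas: "smooth_atlas (atl K)"
  and gam_kform: "gam K \<in> kforms (atl K) 3"
  and gc_p: "generalized_complex (atl K) (gam K) (Jp K)"
  and gc_m: "generalized_complex (atl K) (gam K) (Jm K)"
  using gk by (auto simp: generalized_kaehler_def closed_kform_def)

lemmas V_simps = vfields_add[OF atlas] vfields_diff[OF atlas] vfields_uminus[OF atlas]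
  vfields_zero[OF atlas] vfields_scl[OF atlas] vfields_lie[OF atlas]

lemmas W_simps = oneforms_add[OF atlas] oneforms_uminus[OF atlas]
  oneforms_zero[OF atlas] oneforms_scl[OF atlas]

lemmas TT_simps = ttsections_add[OF atlas] ttsections_diff[OF atlas] ttsections_uminus[OF atlas]
  ttsections_zero[OF atlas] ttsections_ttscl[OF atlas]

section \<open>The musical map of the metric\<close>

lemma g_W: "X \<in> V \<Longrightarrow> g X \<in> W"
  and g_sym: "X \<in> V \<Longrightarrow> Y \<in> V \<Longrightarrow> g X Y = g Y X"
  using gk by (auto simp: generalized_kaehler_def riemannian_metric_def)

text \<open>Linearity is given in the second argument only, because \<open>g X\<close> is a
  one-form; symmetry transfers it to the first.\<close>

lemma g_add: "X \<in> V \<Longrightarrow> Y \<in> V \<Longrightarrow> g (X + Y) = g X + g Y"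
  by (rule oneform_eqI[OF atlas])
    (auto simp: g_W V_simps W_simps g_sym[of "X + Y"] g_sym[of X] g_sym[of Y] oneform_add[OF atlas])

lemma g_scl: "f \<in> smooth_fun (atl K) \<Longrightarrow> X \<in> V \<Longrightarrow> g (scl f X) = scl f (g X)"
  by (rule oneform_eqI[OF atlas])
    (auto simp: g_W V_simps W_simps g_sym[of "scl f X"] g_sym[of X] oneform_scl[OF atlas] scl_apply)

lemma g_uminus: "X \<in> V \<Longrightarrow> g (- X) = - g X"
  using g_scl[OF smooth_fun_uminus[OF atlas smooth_fun_1], of X] by (simp add: scl_minus_one)

lemma g_diff: "X \<in> V \<Longrightarrow> Y \<in> V \<Longrightarrow> g (X - Y) = g X - g Y"
  using g_add[of X "- Y"] by (simp add: g_uminus V_simps)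

text \<open>The difference of two vector fields with the same image has length 0, so by definiteness
  it kills all smooth functions; the other functions it kills by convention.\<close>

lemma g_inj: "inj_on g V"
proof (rule inj_onI)
  fix X Y assume XY: "X \<in> V" "Y \<in> V" "g X = g Y"
  let ?Z = "X - Y"
  have Z: "?Z \<in> V" "g ?Z ?Z = 0"
    using XY by (auto simp: V_simps g_diff)
  have "?Z f p = 0" for f p
  proof (cases "f \<in> smooth_fun (atl K)")
    case True
    have "riemannian_metric (atl K) g"
      using gk by (simp add: generalized_kaehler_def)
    then have "?Z f p \<noteq> 0 \<Longrightarrow> g ?Z ?Z p > 0"
      using Z(1) True unfolding riemannian_metric_def by blast
    then show ?thesis using Z(2) by force
  next
    case False
    then show ?thesis using vfield_outside[OF atlas Z(1)] by simp
  qed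
  then have "?Z = 0" by (intro ext) auto
  then show "X = Y" by simp
qed

lemma sh_g: "X \<in> V \<Longrightarrow> sh (g X) = X"
  unfolding sharp_def by (rule inv_into_f_f[OF g_inj])

section \<open>The structures J_+, J_- and the generalized metric\<close>

lemma J_TT: "a \<in> TT \<Longrightarrow> J a \<in> TT"
  and J_J: "a \<in> TT \<Longrightarrow> J (J a) = - a"
  and J_lin: "f \<in> smooth_fun (atl K) \<Longrightarrow> a \<in> TT \<Longrightarrow> b \<in> TT \<Longrightarrow> J (ttscl f a + b) = ttscl f (J a) + J b"
  using gc_p by (auto simp: generalized_complex_def)

lemma Jm_TT: "a \<in> TT \<Longrightarrow> Jm K a \<in> TT"
  and Jm_Jm: "a \<in> TT \<Longrightarrow> Jm K (Jm K a) = - a"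
  and Jm_lin: "f \<in> smooth_fun (atl K) \<Longrightarrow> a \<in> TT \<Longrightarrow> b \<in> TT
    \<Longrightarrow> Jm K (ttscl f a + b) = ttscl f (Jm K a) + Jm K b"
  using gc_m by (auto simp: generalized_complex_def)

lemma J_add: "a \<in> TT \<Longrightarrow> b \<in> TT \<Longrightarrow> J (a + b) = J a + J b"
  using J_lin[OF smooth_fun_1] by (simp add: ttscl_simps)

lemma J_zero: "J 0 = 0"
  using J_add[of 0 0] by (simp add: TT_simps)

lemma J_ttscl: "f \<in> smooth_fun (atl K) \<Longrightarrow> a \<in> TT \<Longrightarrow> J (ttscl f a) = ttscl f (J a)"
  using J_lin[of f a 0] by (simp add: TT_simps J_zero)

lemma J_uminus: "a \<in> TT \<Longrightarrow> J (- a) = - J a"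
  using J_ttscl[OF smooth_fun_uminus[OF atlas smooth_fun_1], of a] by (simp add: ttscl_simps)

lemma J_diff: "a \<in> TT \<Longrightarrow> b \<in> TT \<Longrightarrow> J (a - b) = J a - J b"
  using J_add[of a "- b"] by (simp add: J_uminus TT_simps)

lemma Jm_uminus:
  assumes "a \<in> TT"
  shows "Jm K (- a) = - Jm K a"
proof -
  have "Jm K (0 + 0) = Jm K 0 + Jm K 0"
    using Jm_lin[OF smooth_fun_1, of 0 0] by (simp add: ttscl_simps TT_simps)
  moreover have "Jm K (- a + 0) = - Jm K a + Jm K 0"
    using Jm_lin[OF smooth_fun_uminus[OF atlas smooth_fun_1] assms, of 0]
    by (simp add: ttscl_simps TT_simps)
  ultimately show ?thesis by simp
qed

definition G where "G a = (sh (snd a), g (fst a))"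

lemma G_eq: "a \<in> TT \<Longrightarrow> G a = - J (Jm K a)"
  using gk by (auto simp: generalized_kaehler_def G_def ttsections_def)

lemma J_Jm: "a \<in> TT \<Longrightarrow> J (Jm K a) = Jm K (J a)"
  using gk by (simp add: generalized_kaehler_def)

lemma G_TT: "a \<in> TT \<Longrightarrow> G a \<in> TT"
  by (simp add: G_eq TT_simps J_TT Jm_TT)

lemma G_G: "a \<in> TT \<Longrightarrow> G (G a) = a"
  by (simp add: G_eq TT_simps J_TT Jm_TT J_uminus Jm_uminus J_J Jm_Jm flip: J_Jm)

lemma G_J: "a \<in> TT \<Longrightarrow> G (J a) = J (G a)"
  by (simp add: G_eq TT_simps J_TT Jm_TT J_uminus flip: J_Jm)

text \<open>Apply J_+ to G = -J_+ J_-. On L_+-bar this turns the eigenvalue condition for J_- into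
  one for G.\<close>

lemma Jm_eq: "a \<in> TT \<Longrightarrow> Jm K a = J (G a)"
  by (simp add: G_eq TT_simps J_TT Jm_TT J_uminus J_J)

text \<open>Surjectivity of g is read off from G^2 = 1 applied to \<open>(0, \<xi>)\<close>;
  together with \<open>sh_g\<close> it makes the \<open>inv_into\<close> in \<open>sharp\<close> a
  two-sided inverse.\<close>

lemma sh_V: "\<xi> \<in> W \<Longrightarrow> sh \<xi> \<in> V"
  and g_sh: "\<xi> \<in> W \<Longrightarrow> g (sh \<xi>) = \<xi>"
  using G_TT[of "(0, \<xi>)"] G_G[of "(0, \<xi>)"]
  by (auto simp: G_def ttsections_def V_simps)

lemma sh_add:
  assumes "\<xi> \<in> W" "\<eta> \<in> W" shows "sh (\<xi> + \<eta>) = sh \<xi> + sh \<eta>"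
  using sh_g[OF vfields_add[OF atlas sh_V[OF assms(1)] sh_V[OF assms(2)]]] assms
  by (simp add: g_add sh_V g_sh)

lemma sh_scl:
  assumes "f \<in> smooth_fun (atl K)" "\<xi> \<in> W" shows "sh (scl f \<xi>) = scl f (sh \<xi>)"
  using sh_g[OF vfields_scl[OF atlas assms(1) sh_V[OF assms(2)]]] assms
  by (simp add: g_scl sh_V g_sh)

lemma sh_uminus: "\<xi> \<in> W \<Longrightarrow> sh (- \<xi>) = - sh \<xi>"
  using sh_scl[OF smooth_fun_uminus[OF atlas smooth_fun_1], of \<xi>] by (simp add: scl_minus_one)

text \<open>\<open>emb s\<close> is the inverse of the anchor on the \<open>s\<close>-eigenbundle of \<open>G\<close>, \<open>part s\<close> the
  projection to that eigenbundle followed by the anchor.\<close>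

definition emb :: "real \<Rightarrow> 'a vf \<Rightarrow> 'a tt" where
  "emb s X = (X, scl (\<lambda>_. s) (g X))"

definition part :: "real \<Rightarrow> 'a tt \<Rightarrow> 'a vf" where
  "part s a = scl (\<lambda>_. 1/2) (fst a + scl (\<lambda>_. s) (sh (snd a)))"

lemma emb_TT: "X \<in> V \<Longrightarrow> emb s X \<in> TT"
  by (simp add: emb_def ttsections_def g_W W_simps smooth_fun_const)

lemma emb_add: "X \<in> V \<Longrightarrow> Y \<in> V \<Longrightarrow> emb s (X + Y) = emb s X + emb s Y"
  by (simp add: emb_def g_add scl_add)

lemma emb_diff: "X \<in> V \<Longrightarrow> Y \<in> V \<Longrightarrow> emb s (X - Y) = emb s X - emb s Y"
  by (simp add: emb_def g_diff scl_diff)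

lemma emb_scl: "f \<in> smooth_fun (atl K) \<Longrightarrow> X \<in> V \<Longrightarrow> emb s (scl f X) = ttscl f (emb s X)"
  by (simp add: emb_def g_scl ttscl_def mult.commute)

lemma fst_emb [simp]: "fst (emb s X) = X"
  by (simp add: emb_def)

lemma part_V: "a \<in> TT \<Longrightarrow> part s a \<in> V"
  by (auto simp: part_def ttsections_def V_simps sh_V smooth_fun_const)

lemma part_add: "a \<in> TT \<Longrightarrow> b \<in> TT \<Longrightarrow> part s (a + b) = part s a + part s b"
  by (auto simp: part_def ttsections_def sh_add scl_add)

lemma part_uminus: "a \<in> TT \<Longrightarrow> part s (- a) = - part s a"
  by (auto simp: part_def ttsections_def sh_uminus scl_uminus scl_diff scl_add)

lemma part_diff: "a \<in> TT \<Longrightarrow> b \<in> TT \<Longrightarrow> part s (a - b) = part s a - part s b"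
  using part_add[of a "- b"] by (simp add: part_uminus TT_simps)

lemma part_ttscl: "f \<in> smooth_fun (atl K) \<Longrightarrow> a \<in> TT \<Longrightarrow> part s (ttscl f a) = scl f (part s a)"
  by (auto simp: part_def ttsections_def ttscl_def sh_scl scl_add mult_ac)

lemma part_emb:
  assumes "s \<in> {1, -1}" "X \<in> V"
  shows "part s (emb s X) = X" "part s (emb (- s) X) = 0"
  using assms
  by (auto simp: part_def emb_def sh_scl smooth_fun_const g_W sh_g scl_half_double scl_minus_one
      fun_const_simps sh_uminus)

text \<open>The summands are \<open>(1 + s G)/2\<close> and \<open>(1 - s G)/2\<close> applied to
  \<open>a\<close>.\<close>

lemma emb_part:
  assumes s: "s \<in> {1, -1}" and a: "a \<in> TT"
  shows "emb s (part s a) + emb (- s) (part (- s) a) = a"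
proof -
  have h: "(\<lambda>_. 1/2) \<in> smooth_fun (atl K)"
    by (rule smooth_fun_const)
  obtain X \<xi> where e: "a = (X, \<xi>)" "X \<in> V" "\<xi> \<in> W"
    using a by (cases a) (auto simp: ttsections_def)
  show ?thesis
    using s
    by (elim insertE emptyE)
      (simp_all add: part_def emb_def e fun_const_simps scl_minus_one g_scl h sh_V V_simps g_add
        g_diff g_sh scl_half_double scl_uminus flip: scl_add scl_diff,
        simp_all add: scl_def fun_eq_iff field_simps)
qed

text \<open>For the converse the one-form component g X = s \<xi> of the eigenvalue equation
  suffices, since s^2 = 1 turns it into \<xi> = s g X.\<close>

lemma emb_iff_G:
  assumes s: "s \<in> {1, -1}" and a: "a \<in> TT"
  shows "a \<in> emb s ` V \<longleftrightarrow> G a = ttscl (\<lambda>_. s) a"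
proof
  show "G a = ttscl (\<lambda>_. s) a" if "a \<in> emb s ` V"
    using that s
    by (auto simp: emb_def G_def ttscl_def sh_scl smooth_fun_const g_W sh_g scl_const_const
        fun_const_simps scl_minus_one sh_uminus)
next
  assume "G a = ttscl (\<lambda>_. s) a"
  then have "g (fst a) = scl (\<lambda>_. s) (snd a)"
    by (simp add: G_def ttscl_def)
  then have "emb s (fst a) = a"
    using s by (auto simp: emb_def scl_const_const fun_const_simps prod_eq_iff)
  moreover have "fst a \<in> V"
    using a by (auto simp: ttsections_def)
  ultimately show "a \<in> emb s ` V"
    by (metis imageI)
qed

section \<open>The complex structures I_s\<close>

lemma I_V: "X \<in> V \<Longrightarrow> I s X \<in> V"
  using J_TT[OF emb_TT[of X s]] by (auto simp: cplx_str_def emb_def ttsections_def)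

text \<open>J_+ commutes with G and hence preserves the s-eigenbundle; a section of that graph is
  determined by its anchor, which here is \<open>cplx_str\<close> by definition.\<close>

lemma J_emb:
  assumes s: "s \<in> {1, -1}" and X: "X \<in> V"
  shows "J (emb s X) = emb s (I s X)"
proof -
  have "G (J (emb s X)) = ttscl (\<lambda>_. s) (J (emb s X))"
    using emb_iff_G[OF s emb_TT[OF X, of s]] X
    by (simp add: G_J emb_TT J_ttscl smooth_fun_const)
  then obtain Y where "J (emb s X) = emb s Y"
    using emb_iff_G[OF s J_TT[OF emb_TT[OF X]]] by auto
  moreover from this have "Y = I s X"
    by (metis cplx_str_def emb_def fst_emb)
  ultimately show ?thesis by simp
qed

lemma I_I:
  assumes s: "s \<in> {1, -1}" and X: "X \<in> V"
  shows "I s (I s X) = - X"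
proof -
  have "emb s (I s (I s X)) = J (J (emb s X))"
    using assms by (simp add: J_emb I_V)
  also have "\<dots> = - emb s X"
    by (simp add: J_J emb_TT X)
  finally show ?thesis
    by (metis fst_emb fst_uminus)
qed

text \<open>Preserving both eigenbundles of G, J_+ commutes with the projections, and the anchor
  turns it into I_s.\<close>

lemma part_J:
  assumes s: "s \<in> {1, -1}" and a: "a \<in> TT"
  shows "part s (J a) = I s (part s a)"
proof -
  have s': "- s \<in> {1, -1}" using s by auto
  have "J a = J (emb s (part s a) + emb (- s) (part (- s) a))"
    using emb_part[OF s a] by simp
  also have "\<dots> = emb s (I s (part s a)) + emb (- s) (I (- s) (part (- s) a))"
    using J_emb[OF s part_V[OF a]] J_emb[OF s' part_V[OF a]] by (simp add: J_add emb_TT part_V a)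
  finally show ?thesis
    using s by (simp add: part_add emb_TT I_V part_V a part_emb)
qed

section \<open>Sections of the eigenbundles\<close>

text \<open>A section of \<open>L\<^sub>+\<close>-bar is determined by its real part, so all complex identities below reduce
  to their real parts.\<close>

definition T :: "'a tt \<Rightarrow> 'a tt cpx" where
  "T a = Cpx a (J a)"

lemma T_inject [simp]: "T a = T b \<longleftrightarrow> a = b"
  by (auto simp: T_def)

lemma re_T [simp]: "re (T a) = a"
  by (simp add: T_def)

lemma T_add: "a \<in> TT \<Longrightarrow> b \<in> TT \<Longrightarrow> T a + T b = T (a + b)"
  by (simp add: T_def plus_cpx_def J_add)

text \<open>Multiplying a + i J a by i replaces the real part a by -J a; this accounts for the term
  with \<open>Im\<close>.\<close>

lemma cttscl_T:
  assumes "a \<in> TT" "f \<in> csmooth_fun (atl K)"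
  shows "cttscl f (T a) = T (ttscl (Re \<circ> f) a - ttscl (Im \<circ> f) (J a))"
proof -
  have "ttscl f' (- a) = - ttscl f' a" for f' :: "'a rfun"
    by (simp add: ttscl_def scl_uminus prod_eq_iff)
  then show ?thesis
    using assms
    by (simp add: T_def cttscl_def csmooth_fun_def J_diff J_ttscl J_TT J_J TT_simps)
qed

text \<open>L_+-bar is the -i-eigenbundle: J_+ (a + i b) = -i (a + i b) says J_+ a = b, and then J_+
  b = -a follows from J_+^2 = -1.\<close>

lemma Lbar_eq: "Lbar K = T ` TT"
proof (intro subset_antisym subsetI)
  fix u assume "u \<in> Lbar K"
  then obtain w where w: "w \<in> Lplus K" "u = cconj w"
    by (auto simp: Lbar_def)
  then have "re w \<in> TT" "u = T (re w)"
    by (auto simp: Lplus_def eigenbundle_def cttsections_def cext_def ii_def T_def cconj_def)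
  then show "u \<in> T ` TT"
    by blast
next
  fix u assume "u \<in> T ` TT"
  then obtain a where a: "a \<in> TT" "u = T a" by blast
  then have "Cpx a (- J a) \<in> Lplus K"
    by (auto simp: Lplus_def eigenbundle_def cttsections_def cext_def ii_def TT_simps J_TT J_uminus J_J)
  moreover have "u = cconj (Cpx a (- J a))"
    using a by (simp add: T_def cconj_def)
  ultimately show "u \<in> Lbar K"
    unfolding Lbar_def by blast
qed

lemma ellbar_Lbar: "ellbar K s = Lbar K \<inter> (if s = 1 then cconj ` Lminus K else Lminus K)"
  by (simp add: ellbar_def ell_def Lbar_def image_Int[OF inj_cconj] image_image)

text \<open>For \<open>T a\<close>, lying in the -i-eigenbundle of J_- means J_- a = J_+ a, and
  lying in the i-eigenbundle means J_- a = -J_+ a. As J_- = J_+ G, these read G a = a and G a = -a,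
  the cases s = 1 and s = -1.\<close>

lemma ellbar_eq:
  assumes s: "s \<in> {1, -1}"
  shows "ellbar K s = (\<lambda>X. T (emb s X)) ` V"
proof -
  have iff: "T a \<in> (if s = 1 then cconj ` Lminus K else Lminus K) \<longleftrightarrow> a \<in> emb s ` V" if a: "a \<in> TT" for a
  proof -
    note Ja = J_TT[OF a] TT_simps(3)[OF J_TT[OF a]]
    have m: "Jm K a = J (G a)" "Jm K (J a) = - G a"
      using a by (simp_all add: Jm_eq J_TT G_J J_J G_TT)
    then have m': "Jm K (- J a) = G a"
      using Ja by (simp add: Jm_uminus)
    have cconj_mem: "T a \<in> cconj ` Lminus K \<longleftrightarrow> Cpx a (- J a) \<in> Lminus K"
    proof -
      have "cconj (Cpx a (- J a)) = T a"
        by (simp add: T_def cconj_def)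
      then show ?thesis
        using inj_image_mem_iff[OF inj_cconj, of "Cpx a (- J a)" "Lminus K"] by simp
    qed
    show ?thesis
    proof (cases "s = 1")
      case True
      have "Cpx a (- J a) \<in> Lminus K \<longleftrightarrow> G a = a"
        using a Ja m m' by (auto simp: Lminus_def eigenbundle_def cttsections_def cext_def ii_def)
      then show ?thesis
        unfolding emb_iff_G[OF s a] by (simp add: True cconj_mem fun_const_simps ttscl_simps)
    next
      case False
      then have s1: "s = -1" using s by simp
      have "T a \<in> Lminus K \<longleftrightarrow> Jm K a = - J a \<and> Jm K (J a) = a"
        using a Ja by (auto simp: T_def Lminus_def eigenbundle_def cttsections_def cext_def ii_def)
      also have "\<dots> \<longleftrightarrow> G a = - a"
        using J_uminus[OF a] m by (auto simp: minus_equation_iff)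
      finally show ?thesis
        unfolding emb_iff_G[OF s a] by (simp add: s1 fun_const_simps ttscl_simps)
    qed
  qed
  show ?thesis
    unfolding ellbar_Lbar Lbar_eq using iff emb_TT by fastforce
qed

lemma anchor_T_emb:
  assumes "s \<in> {1, -1}" "X \<in> V"
  shows "anchor (T (emb s X)) = Cpx X (I s X)"
  using J_emb[OF assms] by (simp add: T_def cext_def)

text \<open>I_s acts as -i on X + i I_s X, so the projection \<open>(1 + i I_s)/2\<close> fixes
  it.\<close>

lemma proj01_anchor:
  assumes "s \<in> {1, -1}" "X \<in> V"
  shows "proj01 K s (Cpx X (I s X)) = Cpx X (I s X)"
  using I_I[OF assms]
  by (simp add: proj01_def cext_def ii_def plus_cpx_def scl_half_double)

text \<open>The anchor of \<open>T (emb s X)\<close> has real part X, so the anchor is injective on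
  \<open>ellbar K s\<close> and its \<open>inv_into\<close> can be evaluated.\<close>

lemma lift_anchor:
  assumes "s \<in> {1, -1}" "X \<in> V"
  shows "lift K s (Cpx X (I s X)) = T (emb s X)"
proof -
  have "inj_on anchor (ellbar K s)"
    by (rule inj_onI) (auto simp: ellbar_eq[OF assms(1)] anchor_T_emb[OF assms(1)])
  moreover have "T (emb s X) \<in> ellbar K s"
    using assms by (simp add: ellbar_eq)
  ultimately show ?thesis
    using inv_into_f_f[of anchor "ellbar K s" "T (emb s X)"]
    by (simp add: lift_def proj01_anchor[OF assms] anchor_T_emb[OF assms])
qed

lemma Lbar_closed: "u \<in> Lbar K \<Longrightarrow> v \<in> Lbar K \<Longrightarrow> cdorfman K u v \<in> Lbar K"
  unfolding Lbar_def Lplus_def by (rule eigenbundle_cconj_closed[OF atlas gam_kform gc_p])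

lemma ellbar_closed: "u \<in> ellbar K s \<Longrightarrow> v \<in> ellbar K s \<Longrightarrow> cdorfman K u v \<in> ellbar K s"
  using Lbar_closed eigenbundle_cconj_closed[OF atlas gam_kform gc_m, of u v] gc_m
  by (auto simp: ellbar_Lbar Lminus_def generalized_complex_def split: if_splits)

section \<open>The quotient and its dual\<close>

context
  fixes s :: real
  assumes s: "s \<in> {1, -1}"
begin

lemma s_neg: "- s \<in> {1, -1}"
  using s by auto

lemma emb_decomp: "a \<in> TT \<Longrightarrow> emb s (part s a) + emb (- s) (part (- s) a) = a"
  by (rule emb_part[OF s])

lemma part_embs:
  assumes "X \<in> V"
  shows "part s (emb s X) = X" "part s (emb (- s) X) = 0"
    "part (- s) (emb (- s) X) = X" "part (- s) (emb s X) = 0"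
  using part_emb[OF s assms] part_emb[OF s_neg assms] by simp_all

text \<open>Adding a section of ellbar_s changes only the s-component of the real part, so a class
  is a fibre of \<open>part (- s)\<close>.\<close>

lemma cls_T:
  assumes a: "a \<in> TT"
  shows "cls K s (T a) = T ` {b \<in> TT. part (- s) b = part (- s) a}"
proof (intro subset_antisym subsetI)
  fix u assume "u \<in> cls K s (T a)"
  then obtain X where "X \<in> V" "u = T (a + emb s X)"
    using a by (auto simp: cls_def ellbar_eq[OF s] T_add emb_TT)
  then show "u \<in> T ` {b \<in> TT. part (- s) b = part (- s) a}"
    using a by (auto simp: TT_simps emb_TT part_add part_embs)
next
  fix u assume "u \<in> T ` {b \<in> TT. part (- s) b = part (- s) a}"
  then obtain b where b: "u = T b" "b \<in> TT" "part (- s) b = part (- s) a" by auto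
  \<comment> \<open>The (-s)-components of \<open>a\<close> and \<open>b\<close> agree, so
    \<open>b\<close> differs from \<open>a\<close> by the s-embedding of this vector field.\<close>
  let ?X = "part s b - part s a"
  have X: "?X \<in> V"
    using a b by (simp add: V_simps part_V)
  have "emb s (part s b) = b - emb (- s) (part (- s) a)"
    using emb_decomp[OF b(2)] b(3) by (simp add: algebra_simps)
  moreover have "emb s (part s a) = a - emb (- s) (part (- s) a)"
    using emb_decomp[OF a] by (simp add: algebra_simps)
  ultimately have "b = a + emb s ?X"
    using a b(2) by (simp add: emb_diff part_V)
  then have "u = T a + T (emb s ?X)"
    using b(1) a X by (simp add: T_add emb_TT)
  then show "u \<in> cls K s (T a)"
    using X by (auto simp: cls_def ellbar_eq[OF s])
qed

lemma cls_T_eq_iff: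
  assumes "a \<in> TT" "b \<in> TT"
  shows "cls K s (T a) = cls K s (T b) \<longleftrightarrow> part (- s) a = part (- s) b"
proof -
  have "T a \<in> cls K s (T b) \<longleftrightarrow> part (- s) a = part (- s) b" "T a \<in> cls K s (T a)"
    using assms by (auto simp: cls_T)
  then show ?thesis
    using assms by (auto simp: cls_T)
qed

lemma cls_T_emb: "a \<in> TT \<Longrightarrow> cls K s (T a) = cls K s (T (emb (- s) (part (- s) a)))"
  by (simp add: cls_T_eq_iff emb_TT part_V part_embs)

lemma ellbar_neg_Lbar: "ellbar K (- s) \<subseteq> Lbar K"
  by (auto simp: ellbar_Lbar)

section \<open>The natural isomorphism and its transpose\<close>

lemma cls_bij: "bij_betw (cls K s) (ellbar K (- s)) (Aquot K s)"
proof (rule bij_betw_imageI)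
  show "inj_on (cls K s) (ellbar K (- s))"
    by (rule inj_onI) (auto simp: ellbar_eq[OF s_neg] cls_T_eq_iff emb_TT part_embs)
  show "cls K s ` ellbar K (- s) = Aquot K s"
    unfolding Aquot_def
  proof (intro subset_antisym subsetI)
    fix c assume "c \<in> cls K s ` Lbar K"
    then obtain a where "a \<in> TT" "c = cls K s (T a)"
      by (auto simp: Lbar_eq)
    then show "c \<in> cls K s ` ellbar K (- s)"
      using cls_T_emb[of a] by (simp add: ellbar_eq[OF s_neg] part_V)
  qed (use ellbar_neg_Lbar in blast)
qed

lemma ellbar_combination:
  assumes "f \<in> csmooth_fun (atl K)" "u \<in> ellbar K (- s)" "v \<in> ellbar K (- s)"
  shows "cttscl f u + v \<in> ellbar K (- s)"
proof -
  obtain X Y where *: "X \<in> V" "u = T (emb (- s) X)" "Y \<in> V" "v = T (emb (- s) Y)"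
    using assms by (auto simp: ellbar_eq[OF s_neg])
  have f: "Re \<circ> f \<in> smooth_fun (atl K)" "Im \<circ> f \<in> smooth_fun (atl K)"
    using assms by (auto simp: csmooth_fun_def)
  \<comment> \<open>Real part of f (X + i I_{-s} X) plus Y: on real parts of (0,1)-vectors,
    multiplication by i is -I_{-s}.\<close>
  let ?Z = "scl (Re \<circ> f) X - scl (Im \<circ> f) (I (- s) X) + Y"
  have "cttscl f u + v = T (emb (- s) ?Z)"
    using * f assms(1)
    by (simp add: cttscl_T T_add emb_TT J_emb[OF s_neg] I_V TT_simps V_simps emb_add emb_diff emb_scl)
  moreover have "?Z \<in> V"
    using * f by (simp add: V_simps I_V)
  ultimately show ?thesis
    by (auto simp: ellbar_eq[OF s_neg])
qed

text \<open>The module structure descends to the quotient because \<open>part (- s)\<close> sees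
  multiplication by i only through I_{-s}, by \<open>part_J\<close>.\<close>

lemma cls_combination:
  assumes f: "f \<in> csmooth_fun (atl K)"
    and L: "u \<in> Lbar K" "v \<in> Lbar K" "u' \<in> Lbar K" "v' \<in> Lbar K"
    and cls: "cls K s u = cls K s u'" "cls K s v = cls K s v'"
  shows "cls K s (cttscl f u + v) = cls K s (cttscl f u' + v')"
proof -
  obtain a b a' b' where *: "u = T a" "v = T b" "u' = T a'" "v' = T b'"
    "a \<in> TT" "b \<in> TT" "a' \<in> TT" "b' \<in> TT"
    using L by (auto simp: Lbar_eq)
  have "Re \<circ> f \<in> smooth_fun (atl K)" "Im \<circ> f \<in> smooth_fun (atl K)"
    using f by (auto simp: csmooth_fun_def)
  then show ?thesis
    using * cls f
    by (simp add: cttscl_T T_add TT_simps J_TT cls_T_eq_iff part_add part_diff part_ttscl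
        part_J[OF s_neg])
qed

text \<open>A functional on the quotient is determined by its values on the complement ellbar_{-s}.
  Conversely, \<beta> is composed with the inverse of \<open>cls K s\<close>, whose linearity over
  functions rests on \<open>cls_combination\<close>.\<close>

lemma cls_transpose_bij: "bij_betw (cls_transpose K s) (A_dual K s) (ellbar_dual K (- s))"
proof (rule bij_betw_imageI)
  have cls_Aquot: "cls K s u \<in> Aquot K s" if "u \<in> Lbar K" for u
    using that by (simp add: Aquot_def)
  show "inj_on (cls_transpose K s) (A_dual K s)"
  proof (rule inj_onI, rule ext)
    fix \<mu> \<nu> c
    assume \<mu>: "\<mu> \<in> A_dual K s" and \<nu>: "\<nu> \<in> A_dual K s" and eq: "cls_transpose K s \<mu> = cls_transpose K s \<nu>"
    show "\<mu> c = \<nu> c"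
    proof (cases "c \<in> Aquot K s")
      case True
      then obtain u where "u \<in> ellbar K (- s)" "c = cls K s u"
        using cls_bij by (auto simp: bij_betw_def)
      then show ?thesis
        using fun_cong[OF eq, of u] by (simp add: cls_transpose_def)
    next
      case False
      then show ?thesis
        using \<mu> \<nu> by (simp add: A_dual_def)
    qed
  qed
  show "cls_transpose K s ` A_dual K s = ellbar_dual K (- s)"
  proof (intro subset_antisym subsetI)
    fix \<beta> assume "\<beta> \<in> cls_transpose K s ` A_dual K s"
    then obtain \<mu> where \<mu>: "\<mu> \<in> A_dual K s" "\<beta> = cls_transpose K s \<mu>" by blast
    have L: "u \<in> Lbar K" if "u \<in> ellbar K (- s)" for u
      using that ellbar_neg_Lbar by blast
    show "\<beta> \<in> ellbar_dual K (- s)"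
      using \<mu>(1) L cls_Aquot ellbar_combination
      unfolding \<mu>(2) ellbar_dual_def cls_transpose_def A_dual_def by simp
  next
    fix \<beta> assume \<beta>: "\<beta> \<in> ellbar_dual K (- s)"
    define r where "r = inv_into (ellbar K (- s)) (cls K s)"
    \<comment> \<open>The default 0 is the one that membership in \<open>A_dual\<close> prescribes
      off the quotient.\<close>
    define \<mu> where "\<mu> c = (if c \<in> Aquot K s then \<beta> (r c) else 0)" for c
    have r: "r c \<in> ellbar K (- s)" "cls K s (r c) = c" if "c \<in> Aquot K s" for c
      using that inv_into_into[of c "cls K s" "ellbar K (- s)"]
        f_inv_into_f[of c "cls K s" "ellbar K (- s)"] cls_bij
      unfolding r_def bij_betw_def by simp_all
    have r_cls: "r (cls K s u) = u" if "u \<in> ellbar K (- s)" for u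
      using that cls_bij unfolding r_def bij_betw_def by auto
    have comb: "r (cls K s (cttscl f u + v)) = cttscl f (r (cls K s u)) + r (cls K s v)"
      and Lcomb: "cttscl f u + v \<in> Lbar K"
      if f: "f \<in> csmooth_fun (atl K)" and uv: "u \<in> Lbar K" "v \<in> Lbar K" for f u v
    proof -
      let ?u = "r (cls K s u)" and ?v = "r (cls K s v)"
      have m: "?u \<in> ellbar K (- s)" "?v \<in> ellbar K (- s)"
        using uv by (simp_all add: r cls_Aquot)
      have "cls K s (cttscl f u + v) = cls K s (cttscl f ?u + ?v)"
        using m uv ellbar_neg_Lbar by (intro cls_combination f) (auto simp: r cls_Aquot)
      then show "r (cls K s (cttscl f u + v)) = cttscl f ?u + ?v"
        by (simp add: r_cls ellbar_combination f m)
      show "cttscl f u + v \<in> Lbar K"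
        using uv f by (auto simp: Lbar_eq cttscl_T T_add TT_simps J_TT csmooth_fun_def)
    qed
    have "\<mu> \<in> A_dual K s"
      unfolding A_dual_def mem_Collect_eq
    proof (intro conjI ballI allI impI)
      fix c assume "c \<in> Aquot K s"
      then show "\<mu> c \<in> csmooth_fun (atl K)"
        using \<beta> r(1) by (simp add: \<mu>_def ellbar_dual_def)
    next
      fix f u v assume *: "f \<in> csmooth_fun (atl K)" "u \<in> Lbar K" "v \<in> Lbar K"
      have "\<beta> (cttscl f (r (cls K s u)) + r (cls K s v))
          = f * \<beta> (r (cls K s u)) + \<beta> (r (cls K s v))"
        using \<beta> * r(1) cls_Aquot unfolding ellbar_dual_def by blast
      then show "\<mu> (cls K s (cttscl f u + v)) = f * \<mu> (cls K s u) + \<mu> (cls K s v)"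
        using * by (simp add: \<mu>_def comb Lcomb cls_Aquot)
    qed (simp add: \<mu>_def)
    moreover have "cls_transpose K s \<mu> = \<beta>"
    proof
      fix u
      show "cls_transpose K s \<mu> u = \<beta> u"
      proof (cases "u \<in> ellbar K (- s)")
        case True
        then show ?thesis
          using ellbar_neg_Lbar by (auto simp: cls_transpose_def \<mu>_def r_cls cls_Aquot)
      next
        case False
        then show ?thesis
          using \<beta> by (simp add: cls_transpose_def ellbar_dual_def)
      qed
    qed
    ultimately show "\<beta> \<in> cls_transpose K s ` A_dual K s" by blast
  qed
qed

section \<open>The Bismut connection as a projected Dorfman bracket\<close>

text \<open>The one-form component of the bracket, combined with \<open>g [X, Y]\<close>, is the right-hand side of the
  Koszul formula, so that pairing the projection with \<open>Z\<close> gives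
  \<open>g(\<nabla>\<^sub>X Y, Z) - s/2 \<gamma>(Y, X, Z)\<close>.\<close>

lemma bismut_eq_part:
  assumes nabla: "levi_civita (atl K) g nabla" and X: "X \<in> V" and Y: "Y \<in> V"
  shows "bismut K nabla (- s) X Y = part (- s) (dorfman (atl K) (gam K) (emb s X) (emb (- s) Y))"
proof -
  define \<zeta> where "\<zeta> = snd (dorfman (atl K) (gam K) (emb s X) (emb (- s) Y))"
  define \<kappa> where "\<kappa> = contract2 (atl K) X Y (gam K)"
  have c: "(\<lambda>_. c) \<in> smooth_fun (atl K)" for c
    by (rule smooth_fun_const)
  have D: "nabla U U' \<in> V" if "U \<in> V" "U' \<in> V" for U U'
    using nabla that by (simp add: levi_civita_def)
  have \<kappa>: "\<kappa> \<in> W"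
    unfolding \<kappa>_def by (rule contract2_oneform[OF atlas gam_kform X Y])
  \<comment> \<open>Chosen so that half the sum of [X, Y] and the vector field dual to this form is
    the Bismut derivative of sign -s.\<close>
  let ?R = "2 * g (nabla X Y) + scl (\<lambda>_. - s) \<kappa> - g (lie X Y)"
  have R: "?R \<in> W"
  proof -
    have "?R = g (nabla X Y) + g (nabla X Y) + scl (\<lambda>_. - s) \<kappa> + - g (lie X Y)"
      by simp
    then show ?thesis
      using D X Y \<kappa> c by (simp only: W_simps g_W V_simps)
  qed
  have koszul: "scl (\<lambda>_. - s) \<zeta> = ?R"
  proof
    fix Z
    show "scl (\<lambda>_. - s) \<zeta> Z = ?R Z"
    proof (cases "Z \<in> V")
      case False
      then show ?thesis
        using oneform_outside[OF atlas R]
        by (simp add: \<zeta>_def dorfman_def scl_apply lie_oneform_def contract_d_def contract2_def as_oneform_def)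
    next
      case Z: True
      have compat: "U (g U' U'') = g (nabla U U') U'' + g U' (nabla U U'')"
        if "U \<in> V" "U' \<in> V" "U'' \<in> V" for U U' U''
        using nabla that unfolding levi_civita_def by blast
      have torsion: "g U (nabla U' U'') = g U (nabla U'' U') + g U (lie U' U'')"
        if "U \<in> V" "U' \<in> V" "U'' \<in> V" for U U' U''
      proof -
        have "lie U' U'' = nabla U' U'' - nabla U'' U'"
          using nabla that by (simp add: levi_civita_def)
        then show ?thesis
          using oneform_diff[OF atlas g_W] that D by simp
      qed
      have sc: "U (scl (\<lambda>_. c) (g U') U'') = (\<lambda>_. c) * U (g U' U'')"
        if "U \<in> V" "U' \<in> V" for U U' U'' c
        using vfield_const_mult[OF atlas that(1) oneform_smooth[OF atlas g_W[OF that(2)]]]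
        by (simp add: scl_apply)
      \<comment> \<open>Both metric terms carry -s: the Lie derivative acts on -s g Y, while the
        contraction of d(s g X) enters with a minus sign.\<close>
      have "\<zeta> Z = - (\<lambda>_. s) * (X (g Y Z) - g Y (lie X Z))
          - (\<lambda>_. s) * (Y (g X Z) - Z (g X Y) - g X (lie Y Z)) + gam K [Y, X, Z]"
        by (simp add: \<zeta>_def dorfman_def emb_def lie_oneform_def contract_d_def contract2_def
            as_oneform_def Z sc X Y)
          (simp add: scl_apply fun_eq_iff algebra_simps)
      also have "\<dots> = - (\<lambda>_. s) * (X (g Y Z) + Y (g X Z) - Z (g X Y) - g Y (lie X Z) - g X (lie Y Z))
          + \<kappa> Z"
        by (simp add: \<kappa>_def contract2_def as_oneform_def Z algebra_simps)
      also have "X (g Y Z) + Y (g X Z) - Z (g X Y) - g Y (lie X Z) - g X (lie Y Z)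
          = g (nabla X Y) Z + g (nabla X Y) Z - g (lie X Y) Z"
      proof -
        \<comment> \<open>Vanishing torsion exchanges the two derivatives; the resulting -[X, Y] is
          what cancels the anchor of the bracket under \<open>part (- s)\<close>.\<close>
        have "g Z (nabla Y X) = g (nabla X Y) Z - g (lie X Y) Z"
          using torsion[OF Z X Y] X Y Z D
          by (simp add: g_sym[of Z] V_simps)
        then have "g (nabla Y X) Z = g (nabla X Y) Z - g (lie X Y) Z"
          using X Y Z D by (simp add: g_sym[of Z])
        moreover have "g (nabla Z X) Y = g Y (nabla Z X)"
          using X Y Z D by (simp add: g_sym)
        ultimately show ?thesis
          using compat[OF X Y Z] compat[OF Y X Z] compat[OF Z X Y] torsion[OF Y X Z] torsion[OF X Y Z]
          by (simp add: algebra_simps)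
      qed
      finally have "\<zeta> Z = - (\<lambda>_. s) * (g (nabla X Y) Z + g (nabla X Y) Z - g (lie X Y) Z) + \<kappa> Z" .
      then show ?thesis
        using s by (auto simp: fun_eq_iff scl_apply algebra_simps)
    qed
  qed
  \<comment> \<open>Multiplication by -s is its own inverse.\<close>
  have \<zeta>: "\<zeta> = scl (\<lambda>_. - s) ?R"
    unfolding koszul[symmetric] using s by (auto simp: scl_def fun_eq_iff)
  have "part (- s) (dorfman (atl K) (gam K) (emb s X) (emb (- s) Y))
      = scl (\<lambda>_. 1/2) (lie X Y + scl (\<lambda>_. - s) (sh \<zeta>))"
    by (simp add: part_def \<zeta>_def) (simp add: dorfman_def)
  also have "scl (\<lambda>_. - s) (sh \<zeta>) = sh ?R"
    unfolding \<zeta> sh_scl[OF c R] using s by (auto simp: scl_def fun_eq_iff)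
  also have "sh ?R = nabla X Y + nabla X Y + scl (\<lambda>_. - s) (sh \<kappa>) - lie X Y"
  proof -
    have "?R = g (nabla X Y) + g (nabla X Y) + scl (\<lambda>_. - s) \<kappa> + - g (lie X Y)"
      by simp
    then show ?thesis
      using D X Y \<kappa> c
      by (simp only: sh_add sh_uminus sh_scl sh_g W_simps g_W V_simps) simp
  qed
  finally show ?thesis
    by (simp add: bismut_def \<kappa>_def) (simp add: scl_def fun_eq_iff field_simps)
qed

section \<open>Comparison of the two operators\<close>

text \<open>Bilinearity splits the complex bracket into real ones, each projecting to a Bismut
  derivative. Reassembled, they give Z + i I_{-s} Z with Z = \<open>part (- s) c\<close>; being of
  type (0,1) already, it lifts without loss.\<close>

lemma dorfman_lift:
  assumes nabla: "levi_civita (atl K) g nabla" and X: "X \<in> V" and Y: "Y \<in> V"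
  defines "c \<equiv> re (cdorfman K (T (emb s X)) (T (emb (- s) Y)))"
  shows "c \<in> TT" "cdorfman K (T (emb s X)) (T (emb (- s) Y)) = T c"
    "lift K (- s) (cext2 (bismut K nabla (- s)) (Cpx X (I s X)) (Cpx Y (I (- s) Y)))
      = T (emb (- s) (part (- s) c))"
proof -
  let ?d = "dorfman (atl K) (gam K)"
  have L: "T (emb s X) \<in> Lbar K" "T (emb (- s) Y) \<in> Lbar K"
    using X Y by (auto simp: Lbar_eq emb_TT)
  then obtain c' where "c' \<in> TT" "cdorfman K (T (emb s X)) (T (emb (- s) Y)) = T c'"
    using Lbar_closed[OF L] by (auto simp: Lbar_eq)
  then show c: "c \<in> TT" "cdorfman K (T (emb s X)) (T (emb (- s) Y)) = T c"
    by (simp_all add: c_def)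
  note d_TT = dorfman_ttsections[OF atlas gam_kform]
  have parts: "cext2 (bismut K nabla (- s)) (Cpx X (I s X)) (Cpx Y (I (- s) Y))
      = Cpx (part (- s) c) (part (- s) (J c))"
  proof -
    have "c = ?d (emb s X) (emb (- s) Y) - ?d (emb s (I s X)) (emb (- s) (I (- s) Y))"
      using X Y by (simp add: c_def T_def cext2_def J_emb[OF s] J_emb[OF s_neg])
    \<comment> \<open>Involutivity enters here: the imaginary part of the bracket, on the right, is
      J_+ of its real part.\<close>
    moreover have "J c = ?d (emb s X) (emb (- s) (I (- s) Y)) + ?d (emb s (I s X)) (emb (- s) Y)"
      using c(2) X Y by (simp add: T_def cext2_def J_emb[OF s] J_emb[OF s_neg])
    ultimately show ?thesis
      using X Y
      by (simp add: cext2_def bismut_eq_part[OF nabla] I_V part_add part_diff d_TT emb_TT)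
  qed
  show "lift K (- s) (cext2 (bismut K nabla (- s)) (Cpx X (I s X)) (Cpx Y (I (- s) Y)))
      = T (emb (- s) (part (- s) c))"
    unfolding parts part_J[OF s_neg c(1)] by (rule lift_anchor[OF s_neg part_V[OF c(1)]])
qed

lemma dbar_A_lift:
  assumes nabla: "levi_civita (atl K) g nabla" and X: "X \<in> V" and Y: "Y \<in> V"
  shows "dbar_A K s (Cpx X (I s X)) (cls K s (T (emb (- s) Y)))
    = cls K s (cdorfman K (T (emb s X)) (T (emb (- s) Y)))"
proof -
  let ?u = "T (emb s X)" and ?v = "T (emb (- s) Y)"
  let ?d = "dorfman (atl K) (gam K)"
  have eq: "cls K s (cdorfman K ?u w) = cls K s (cdorfman K ?u ?v)" if w: "w \<in> cls K s ?v" for w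
  proof -
    obtain w' where w': "w' \<in> ellbar K s" "w = ?v + w'"
      using w by (auto simp: cls_def)
    obtain X' where X': "X' \<in> V" "w' = T (emb s X')"
      using w'(1) by (auto simp: ellbar_eq[OF s])
    have u: "?u \<in> ellbar K s"
      using X by (auto simp: ellbar_eq[OF s])
    obtain Z where Z: "Z \<in> V" "cdorfman K ?u w' = T (emb s Z)"
      using ellbar_closed[OF u w'(1)] by (auto simp: ellbar_eq[OF s])
    obtain c where c: "c \<in> TT" "cdorfman K ?u ?v = T c"
      using dorfman_lift(1,2)[OF nabla X Y] by blast
    have "cdorfman K ?u w = cdorfman K ?u ?v + cdorfman K ?u w'"
      using X Y X'(1)
      by (simp add: w'(2) X'(2) cext2_def plus_cpx_def T_def emb_TT J_TT
          dorfman_add_right[OF atlas gam_kform] algebra_simps)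
    also have "\<dots> = T (c + emb s Z)"
      unfolding c(2) Z(2) by (rule T_add[OF c(1) emb_TT[OF Z(1)]])
    finally show ?thesis
      unfolding c(2) using c(1) Z(1)
      by (simp add: cls_T_eq_iff emb_TT TT_simps part_add part_embs)
  qed
  \<comment> \<open>Equal classes determine their union only if there is at least one;
    \<open>?v\<close> represents its own class.\<close>
  have "?v \<in> cls K s ?v"
    using Y by (auto simp: cls_T emb_TT)
  then show ?thesis
    unfolding dbar_A_def lift_anchor[OF s X] using eq by blast
qed

text \<open>In bidegree (0,1) both sides are the derivative of a value minus the functional at a
  differentiated argument. It remains to match these arguments: \<open>w\<close> is the lift of the
  Bismut derivative and at the same time the representative in ellbar_{-s} of the class of the
  bracket.\<close>

lemma delta_eq_dbar_A_dual:
  assumes nabla: "levi_civita (atl K) g nabla"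
    and u: "u \<in> ellbar K s" and v: "v \<in> ellbar K (- s)"
  shows "delta K nabla s (deg01 (cls_transpose K s \<mu>)) [u] [v]
    = dbar_A_dual K s (anchor u) \<mu> (cls K s v)"
proof -
  obtain X Y where X: "X \<in> V" "u = T (emb s X)" and Y: "Y \<in> V" "v = T (emb (- s) Y)"
    using u v by (auto simp: ellbar_eq[OF s] ellbar_eq[OF s_neg])
  note c = dorfman_lift[OF nabla X(1) Y(1)]
  define w where "w = T (emb (- s) (part (- s) (re (cdorfman K u v))))"
  have w: "w \<in> ellbar K (- s)" "cls K s w = cls K s (cdorfman K u v)"
    using c(1,2) cls_T_emb[OF c(1)] by (auto simp: w_def X Y ellbar_eq[OF s_neg] part_V)
  have lift_v: "lift K (- s) (anchor v) = v"
    using lift_anchor[OF s_neg Y(1)] anchor_T_emb[OF s_neg Y(1)] Y(2) by simp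
  have proj_u: "proj01 K s (anchor u) = anchor u"
    using proj01_anchor[OF s X(1)] anchor_T_emb[OF s X(1)] X(2) by simp
  have lift_w: "lift K (- s) (cext2 (bismut K nabla (- s)) (anchor u) (anchor v)) = w"
    using c(3) anchor_T_emb[OF s X(1)] anchor_T_emb[OF s_neg Y(1)] X(2) Y(2) by (simp add: w_def)
  \<comment> \<open>With a single slot \<open>u\<close>, the Cartan formula has one covariant term,
    of sign 1, and an empty double sum of brackets.\<close>
  have "delta K nabla s (deg01 (cls_transpose K s \<mu>)) [u] [v]
      = cact (anchor u) (cls_transpose K s \<mu> v) - cls_transpose K s \<mu> w"
    by (simp add: delta_def delta_form_def cartan_diff_def covd_form_def deg01_def drop_nth_def
        proj_u lift_v lift_w)
  also have "\<dots> = cact (anchor u) (\<mu> (cls K s v)) - \<mu> (cls K s (cdorfman K u v))"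
    using v w by (simp add: cls_transpose_def)
  also have "cls K s (cdorfman K u v) = dbar_A K s (anchor u) (cls K s v)"
    using dbar_A_lift[OF nabla X(1) Y(1)] anchor_T_emb[OF s X(1)] X(2) Y(2) by simp
  finally show ?thesis
    by (simp only: dbar_A_dual_def)
qed

end

end

theorem lemma3p5:
  fixes K :: "('a::{t2_space,second_countable_topology}, 'e::euclidean_space) gk"
    and nabla :: "'a vf \<Rightarrow> 'a vf \<Rightarrow> 'a vf"
    and s :: real
  assumes "generalized_kaehler K"
    and "levi_civita (atl K) (met K) nabla"
    and "s \<in> {1, -1}"
  shows "bij_betw (cls K s) (ellbar K (- s)) (Aquot K s)
    \<and> bij_betw (cls_transpose K s) (A_dual K s) (ellbar_dual K (- s))
    \<and> (\<forall>\<mu>\<in>A_dual K s. \<forall>u\<in>ellbar K s. \<forall>v\<in>ellbar K (- s).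
         delta K nabla s (deg01 (cls_transpose K s \<mu>)) [u] [v]
           = dbar_A_dual K s (anchor u) \<mu> (cls K s v))"
proof -
  interpret gkaehler K
    by standard (rule assms(1))
  show ?thesis
    using cls_bij[OF assms(3)] cls_transpose_bij[OF assms(3)]
      delta_eq_dbar_A_dual[OF assms(3,2)] by blast
qed

end
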